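(* Let $\mathcal{T}$ be a tree on $k$ vertices, let $G_1,\dots,G_k$ be connected graphs, and let $G$ be a chain of $G_1,\dots,G_k$ with respect to $\mathcal{T}$, where $G$ has at least one edge. Then $$\kappa(G)=\sum_{i=1}^k\kappa(G_i)+\sum_{x\sim y\in\mathcal{B}_G}\left(\frac{\overline{W}_x}{m_G}\alpha_{G_x}(x)+\frac{\overline{W}_y}{m_G}\alpha_{G_y}(y)\right)+\sum_{i=1}^{k}\sum_{(z_1,z_2)\in\widetilde{V}_i\times\widetilde{V}_i}\frac{\overline{W}_{z_1}\overline{W}_{z_2}}{2m_Gm_{G_i}}\left(m^{(G_i)}_{z_1,z_2}+m^{(G_i)}_{z_2,z_1}\right)+\sum_{x\sim y\in\mathcal{B}_G}\frac{(2\overline{W}_x-1)(2\overline{W}_y-1)}{2m_G},$$ where $m^{(G_i)}_{z_1,z_2}$ is the mean first passage time from $z_1$ to $z_2$ for the simple random walk on $G_i$, and terms of the third sum in which $z_1$ and $z_2$ are the same vertex are $0$.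
   Context: All graphs are finite, simple and undirected. For a graph $H$, $m_H$ is the number of edges. For a connected graph $H$, consider the simple random walk on $H$ (from a vertex, move to a uniformly random neighbour), with stationary distribution $\pi_j=\deg_H(j)/(2m_H)$ and mean first passage times $m_{i,j}$ from $i$ to $j$ ($i\ne j$). Kemeny's constant is $\kappa(H)=\sum_{j\neq i}\pi_jm_{i,j}$, which does not depend on the choice of the vertex $i$. The accessibility index of a vertex $v$ in $H$ is $\alpha_H(v)=\sum_{i\neq v}\pi_i m_{i,v}$. For a single-vertex graph both are $0$ (empty sums). Chain: let $\mathcal{T}$ be a tree with vertex set $\{1,\dots,k\}$ and $G_1,\dots,G_k$ connected graphs (on disjoint vertex sets). A chain of $G_1,\dots,G_k$ with respect to $\mathcal{T}$ is a graph $G$ obtained from the disjoint union of $G_1,\dots,G_k$ by choosing, for each edge $i\sim j$ of $\mathcal{T}$, some vertex $v_i\in V(G_i)$ and some vertex $v_j\in V(G_j)$ and adding the edge $v_i\sim v_j$ (the choices for different edges of $\mathcal{T}$ are independent; the same vertex may be chosen several times). $\mathcal{B}_G$ is the set of the $k-1$ added edges; each is a bridge of $G$. For a vertex $z$ of $G$, $G_z$ denotes the graph $G_j$ with $z\in V(G_j)$. $\widetilde{V}_i$ is the collection of ends in $V(G_i)$ of bridges in $\mathcal{B}_G$, one element for each bridge in $\mathcal{B}_G$ having an end in $G_i$; so $|\widetilde{V}_i|=\deg_{\mathcal{T}}(i)$, and a vertex incident to several bridges of $\mathcal{B}_G$ occurs once for each of them. For an end $x$ of a bridge $x\sim y\in\mathcal{B}_G$,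 $W_x$ is the number of edges of the component containing $x$ of $G$ with the edge $x\sim y$ removed, and $\overline{W}_x=m_G-W_x$ (so these numbers depend on the end together with its bridge); in particular $\overline{W}_x=W_y+1$. *)

theory Defs
  imports
    "HOL-Probability.Probability_Mass_Function"
    "HOL-Library.Disjoint_Sets"
    "Graph_Theory.Digraph_Component"
begin

text \<open>
  Finite simple undirected graphs are the symmetric loop-free finite digraphs
  (\<^locale>\<open>pair_graph\<close>): an edge \<open>u \<sim> v\<close> is the pair of opposite arcs \<open>(u, v)\<close>, \<open>(v, u)\<close>.
  The name \<open>connected\<close> is qualified to keep it apart from topological connectedness; it includes
  that the graph has at least one vertex.
\<close>

definition connected_graph :: "'a pair_pre_digraph \<Rightarrow> bool" where
  "connected_graph H \<longleftrightarrow> pair_graph H \<and> Digraph_Component.connected (with_proj H)"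

text \<open>
  The library predicate \<open>tree\<close> is not usable for symmetric digraphs, since it counts
  \<open>(u, v), (v, u)\<close> as a cycle. A cycle of an undirected graph has length at least 3.
\<close>

definition tree_graph :: "'a pair_pre_digraph \<Rightarrow> bool" where
  "tree_graph H \<longleftrightarrow>
     connected_graph H \<and> \<not> (\<exists>p. pre_digraph.cycle (with_proj H) p \<and> length p \<ge> 3)"

definition num_edges :: "'a pair_pre_digraph \<Rightarrow> nat" where
  "num_edges H = card (parcs H) div 2"

subsection \<open>Simple random walk\<close>

definition rw_step :: "'a pair_pre_digraph \<Rightarrow> 'a \<Rightarrow> 'a pmf" where
  "rw_step H v = pmf_of_set {w. (v, w) \<in> parcs H}"

text \<open>The law of the trajectory \<open>[X\<^sub>0, \<dots>, X\<^sub>n]\<close> of the walk started at \<open>v\<close>.\<close>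

primrec rw_path :: "'a pair_pre_digraph \<Rightarrow> nat \<Rightarrow> 'a \<Rightarrow> 'a list pmf" where
  "rw_path H 0 v = return_pmf [v]"
| "rw_path H (Suc n) v = bind_pmf (rw_step H v) (\<lambda>w. map_pmf (\<lambda>xs. v # xs) (rw_path H n w))"

text \<open>
  With \<open>T = min {t \<ge> 1. X\<^sub>t = j}\<close> for the walk started at \<open>i\<close>, these are \<open>P (T = n)\<close> (an event
  that depends on the first \<open>n\<close> steps only) and the expectation of \<open>T\<close>. On a finite connected
  graph, for \<open>i \<noteq> j\<close>, \<open>T\<close> is almost surely finite and the series converges. Only such pairs
  are used below.
\<close>

definition first_passage_prob :: "'a pair_pre_digraph \<Rightarrow> 'a \<Rightarrow> 'a \<Rightarrow> nat \<Rightarrow> real" where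
  "first_passage_prob H i j n =
     measure_pmf.prob (rw_path H n i) {xs. n \<ge> 1 \<and> xs ! n = j \<and> (\<forall>t\<in>{1..<n}. xs ! t \<noteq> j)}"

definition mfpt :: "'a pair_pre_digraph \<Rightarrow> 'a \<Rightarrow> 'a \<Rightarrow> real" where
  "mfpt H i j = (\<Sum>n. real n * first_passage_prob H i j n)"

definition stationary :: "'a pair_pre_digraph \<Rightarrow> 'a \<Rightarrow> real" where
  "stationary H v = real (out_degree (with_proj H) v) / (2 * real (num_edges H))"

text \<open>The common value, for all vertices \<open>i\<close>, of the sum defining Kemeny's constant.\<close>

definition kemeny :: "'a pair_pre_digraph \<Rightarrow> real" where
  "kemeny H = (THE K. \<forall>i\<in>pverts H. K = (\<Sum>j\<in>pverts H - {i}. stationary H j * mfpt H i j))"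

definition accessibility_index :: "'a pair_pre_digraph \<Rightarrow> 'a \<Rightarrow> real" where
  "accessibility_index H v = (\<Sum>i\<in>pverts H - {v}. stationary H i * mfpt H i v)"

subsection \<open>Chains of graphs along a tree\<close>

text \<open>
  In the following, \<open>c i j\<close> is the vertex of \<open>Gs i\<close> chosen for the edge \<open>i \<sim> j\<close> of the tree \<open>T\<close>;
  this edge gives rise to the bridge \<open>c i j \<sim> c j i\<close>.
\<close>

definition chain ::
    "nat pair_pre_digraph \<Rightarrow> (nat \<Rightarrow> 'a pair_pre_digraph) \<Rightarrow> (nat \<Rightarrow> nat \<Rightarrow> 'a) \<Rightarrow> 'a pair_pre_digraph"
  where
  "chain T Gs c =
     \<lparr> pverts = (\<Union>i\<in>pverts T. pverts (Gs i)),
       parcs = (\<Union>i\<in>pverts T. parcs (Gs i)) \<union> {(c i j, c j i) | i j. (i, j) \<in> parcs T} \<rparr>"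

text \<open>One representative arc for each of the added edges, directed by the order of the parts.\<close>

definition bridges :: "nat pair_pre_digraph \<Rightarrow> (nat \<Rightarrow> nat \<Rightarrow> 'a) \<Rightarrow> ('a \<times> 'a) set" where
  "bridges T c = {(c i j, c j i) | i j. (i, j) \<in> parcs T \<and> i < j}"

text \<open>
  The bridge ends in part \<open>i\<close>. An end \<open>x\<close> of a bridge \<open>x \<sim> y\<close> is represented by the arc
  \<open>(x, y)\<close>, so that a vertex incident to several bridges occurs once for each of them.
\<close>

definition bridge_ends ::
    "nat pair_pre_digraph \<Rightarrow> (nat \<Rightarrow> nat \<Rightarrow> 'a) \<Rightarrow> nat \<Rightarrow> ('a \<times> 'a) set" where
  "bridge_ends T c i = {(c i j, c j i) | j. (i, j) \<in> parcs T}"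

definition part_of ::
    "nat pair_pre_digraph \<Rightarrow> (nat \<Rightarrow> 'a pair_pre_digraph) \<Rightarrow> 'a \<Rightarrow> 'a pair_pre_digraph" where
  "part_of T Gs z = Gs (THE j. j \<in> pverts T \<and> z \<in> pverts (Gs j))"

definition del_edge :: "'a pair_pre_digraph \<Rightarrow> 'a \<Rightarrow> 'a \<Rightarrow> 'a pair_pre_digraph" where
  "del_edge H x y = \<lparr> pverts = pverts H, parcs = parcs H - {(x, y), (y, x)} \<rparr>"

definition component_of :: "'a pair_pre_digraph \<Rightarrow> 'a \<Rightarrow> 'a pair_pre_digraph" where
  "component_of H x =
     \<lparr> pverts = {v. reachable (with_proj H) x v},
       parcs = {(u, v) \<in> parcs H. reachable (with_proj H) x u \<and> reachable (with_proj H) x v} \<rparr>"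

text \<open>\<open>W\<^sub>x\<close> and its complement, for the end \<open>x\<close> of the bridge \<open>x \<sim> y\<close>.\<close>

definition W :: "'a pair_pre_digraph \<Rightarrow> 'a \<Rightarrow> 'a \<Rightarrow> nat" where
  "W G x y = num_edges (component_of (del_edge G x y) x)"

definition Wbar :: "'a pair_pre_digraph \<Rightarrow> 'a \<Rightarrow> 'a \<Rightarrow> real" where
  "Wbar G x y = real (num_edges G) - real (W G x y)"

end

(*
  Effective resistances r satisfy sum_(u,v) d_u d_v r(u,v) = 4 m kappa and
  sum_u d_u r(u,v) = alpha(v) + kappa, and r(u,v) is the potential difference between u and v
  for a unit current from u to v, that is, for any function whose Laplacian is the indicator of u
  minus the indicator of v. In a chain G the current enters the part G_i at the gate p_i(u), the
  vertex of G_i closest to u, leaves it at p_i(v), and crosses exactly the bridges that separate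
  u from v; hence
    r_G(u,v) = sum_i r_(G_i)(p_i(u), p_i(v)) + (number of bridges separating u from v).
  Weighting by the degrees, the push-forward of the degree measure of G along p_i is the degree
  measure of G_i plus a mass 2 Wbar_z at each bridge end z of G_i. Expanding the quadratic form
  r_(G_i) on this measure gives the first three sums of the theorem, and the separating bridges
  give the last one.
*)

theory Submission
  imports Defs
begin

subsection \<open>Connected graphs and the Laplacian\<close>

text \<open>Hitting times are not symmetric and do not split along a chain in an evident way.
  Commute times do, and they suffice because the doubly degree-weighted sum of hitting times is
  unchanged when \<open>u\<close> and \<open>v\<close> are exchanged. From the series defining
  \<open>mfpt\<close> a single fact is extracted, the first step equation. It presupposes
  convergence, which is the purpose of the survival probabilities. In Laplacian form it says that
  the hitting times to a fixed target have a source \<open>deg\<close> at every vertex and a sink of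
  strength 2m at the target. The difference of two such functions is therefore the potential of a
  current between the two targets, obtained without inverting the Laplacian; the maximum principle
  makes it unique up to a constant. On G the unit-current potential is glued from two kinds of
  functions: the potentials of the parts composed with the gate maps, which are flat along every
  bridge and outside their own part, and the indicators of the sides of the bridges, which are flat
  inside every part.\<close>

text \<open>Later arguments run on the bare arc relation; by its symmetry, weak connectedness is the
  same as \<open>rtrancl\<close> between any two vertices.\<close>

lemma connected_graph_iff:
  "connected_graph H \<longleftrightarrow>
     pverts H \<noteq> {} \<and> finite (pverts H) \<and> parcs H \<subseteq> pverts H \<times> pverts H \<and>
     sym (parcs H) \<and> irrefl (parcs H) \<and>
     (\<forall>u\<in>pverts H. \<forall>v\<in>pverts H. (u, v) \<in> (parcs H)\<^sup>*)"
  (is "?L \<longleftrightarrow> ?R")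
proof
  assume ?L
  then have pg: "pair_graph H" and conn: "Digraph_Component.connected (with_proj H)"
    by (auto simp: connected_graph_def)
  interpret pair_graph H by (fact pg)
  have "strongly_connected (with_proj H)"
    using symmetric_connected_imp_strongly_connected[OF sym_arcs conn] .
  moreover have "irrefl (parcs H)"
    using pair_no_loops by (fastforce simp: irrefl_def)
  ultimately show ?R
    using pair_finite_verts in_arcsD1 in_arcsD2 pair_sym_arcs
    by (auto simp: strongly_connected_def symmetric_def reachable_conv)
next
  assume R: ?R
  then have fin: "finite (parcs H)"
    by (meson finite_SigmaI finite_subset)
  have pg: "pair_graph H"
    using R fin by unfold_locales (auto simp: symmetric_def irrefl_def)
  interpret pair_graph H by (fact pg)
  have "strongly_connected (with_proj H)"
    using R by (auto simp: strongly_connected_def reachable_conv)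
  then have "Digraph_Component.connected (with_proj H)"
    unfolding connected_def strongly_connected_def
    using reachable_mk_symmetricI by auto
  with pg show ?L by (simp add: connected_graph_def)
qed

text \<open>Arcs are removed in opposite pairs. This makes the \<open>div 2\<close> in
  \<open>num_edges\<close> exact.\<close>

lemma even_card_sym_irrefl:
  assumes "finite A" and "sym A" and "irrefl A"
  shows "even (card A)"
  using assms
proof (induction A rule: finite_psubset_induct)
  case (psubset A)
  show ?case
  proof (cases "A = {}")
    case False
    then obtain a b where ab: "(a, b) \<in> A" by auto
    with psubset.prems have ba: "(b, a) \<in> A" and ne: "a \<noteq> b"
      by (auto simp: irrefl_def dest: symD)
    let ?B = "A - {(a, b), (b, a)}"
    have "even (card ?B)"
      using psubset.prems ab by (intro psubset.IH) (auto simp: sym_def irrefl_def)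
    moreover have "card A = card ?B + 2"
      using card_mono[OF psubset.hyps, of "{(a, b), (b, a)}"] ab ba ne
      by (simp add: card_Diff_subset)
    ultimately show ?thesis by simp
  qed simp
qed

definition nbrs :: "'a pair_pre_digraph \<Rightarrow> 'a \<Rightarrow> 'a set" where
  "nbrs H v = {w. (v, w) \<in> parcs H}"

definition deg :: "'a pair_pre_digraph \<Rightarrow> 'a \<Rightarrow> real" where
  "deg H v = real (card (nbrs H v))"

text \<open>Degree matrix minus adjacency matrix: the net current out of \<open>v\<close> when
  \<open>f\<close> is a voltage and every edge has unit resistance.\<close>

definition laplacian :: "'a pair_pre_digraph \<Rightarrow> ('a \<Rightarrow> real) \<Rightarrow> 'a \<Rightarrow> real" where
  "laplacian H f v = (\<Sum>w\<in>nbrs H v. f v - f w)"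

lemma laplacian_diff:
  "laplacian H (\<lambda>x. f x - g x) v = laplacian H f v - laplacian H g v"
  by (simp add: laplacian_def sum_subtractf[symmetric] algebra_simps)

lemma laplacian_divide:
  "laplacian H (\<lambda>x. f x / c) v = laplacian H f v / c"
  by (simp add: laplacian_def sum_divide_distrib diff_divide_distrib)

locale conn_graph =
  fixes H :: "'a pair_pre_digraph"
  assumes connected_graph: "connected_graph H"
begin

lemma
  shows verts_nonempty: "pverts H \<noteq> {}"
    and finite_verts: "finite (pverts H)"
    and parcs_subset: "parcs H \<subseteq> pverts H \<times> pverts H"
    and sym_parcs: "sym (parcs H)"
    and irrefl_parcs: "irrefl (parcs H)"
    and path_exists: "u \<in> pverts H \<Longrightarrow> v \<in> pverts H \<Longrightarrow> (u, v) \<in> (parcs H)\<^sup>*"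
  using connected_graph by (auto simp: connected_graph_iff)

lemma finite_parcs: "finite (parcs H)"
  using finite_verts parcs_subset by (meson finite_SigmaI finite_subset)

lemma nbrs_subset: "nbrs H v \<subseteq> pverts H"
  using parcs_subset by (auto simp: nbrs_def)

lemma finite_nbrs: "finite (nbrs H v)"
  using nbrs_subset finite_verts by (rule finite_subset)

lemma walk_induct [consumes 2, case_names base step]:
  assumes "u \<in> pverts H" and "v \<in> pverts H" and "P u"
    and "\<And>x y. x \<in> pverts H \<Longrightarrow> y \<in> nbrs H x \<Longrightarrow> P x \<Longrightarrow> P y"
  shows "P v"
  using path_exists[OF assms(1,2)]
proof (induction rule: rtrancl_induct)
  case (step y z)
  then show ?case using assms(4)[of y z] parcs_subset by (auto simp: nbrs_def)
qed (rule assms(3))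

lemma deg_nonneg: "deg H v \<ge> 0"
  by (simp add: deg_def)

lemma deg_pos_iff: "deg H v > 0 \<longleftrightarrow> nbrs H v \<noteq> {}"
  using finite_nbrs by (simp add: deg_def card_gt_0_iff)

text \<open>Reversal of all arcs, that is, reversibility of the walk. Conservation of current
  (\<open>sum_laplacian\<close>) and the mass balance of the survival probabilities both rest on
  it.\<close>

lemma sum_nbrs_swap:
  fixes F :: "'a \<Rightarrow> 'a \<Rightarrow> real"
  shows "(\<Sum>u\<in>pverts H. \<Sum>w\<in>nbrs H u. F u w) = (\<Sum>u\<in>pverts H. \<Sum>w\<in>nbrs H u. F w u)"
proof -
  have *: "nbrs H u = {w \<in> pverts H. (u, w) \<in> parcs H}" for u
    using nbrs_subset by (auto simp: nbrs_def)
  have **: "nbrs H u = {w \<in> pverts H. (w, u) \<in> parcs H}" for u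
    using nbrs_subset sym_parcs by (auto simp: nbrs_def dest: symD)
  have "(\<Sum>u\<in>pverts H. \<Sum>w\<in>nbrs H u. F u w)
      = (\<Sum>u\<in>pverts H. \<Sum>w\<in>{w\<in>pverts H. (u, w) \<in> parcs H}. F u w)"
    by (simp only: *)
  also have "\<dots> = (\<Sum>w\<in>pverts H. \<Sum>u\<in>{u\<in>pverts H. (u, w) \<in> parcs H}. F u w)"
    by (rule sum.swap_restrict) (auto simp: finite_verts)
  finally show ?thesis by (simp only: **[symmetric])
qed

lemma sum_deg: "(\<Sum>v\<in>pverts H. deg H v) = 2 * real (num_edges H)"
proof -
  have "parcs H = (SIGMA v:pverts H. nbrs H v)"
    using parcs_subset by (auto simp: nbrs_def)
  then have "card (parcs H) = (\<Sum>v\<in>pverts H. card (nbrs H v))"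
    using finite_verts finite_nbrs by (simp add: card_SigmaI)
  moreover have "even (card (parcs H))"
    using finite_parcs sym_parcs irrefl_parcs by (rule even_card_sym_irrefl)
  ultimately have "2 * num_edges H = (\<Sum>v\<in>pverts H. card (nbrs H v))"
    by (simp add: num_edges_def)
  then have "real (2 * num_edges H) = real (\<Sum>v\<in>pverts H. card (nbrs H v))"
    by (simp only:)
  then show ?thesis by (simp add: deg_def)
qed

lemma num_edges_eq_0D:
  assumes "num_edges H = 0" and "u \<in> pverts H" and "v \<in> pverts H"
  shows "u = v"
proof -
  have "\<forall>v\<in>pverts H. deg H v = 0"
    using sum_deg assms(1) finite_verts deg_nonneg sum_nonneg_eq_0_iff[of "pverts H" "deg H"]
    by simp
  then have no: "deg H x = 0" "nbrs H x = {}" if "x \<in> pverts H" for x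
    using that deg_pos_iff[of x] by auto
  show "u = v"
    using assms(2,3) by (induction rule: walk_induct) (use no in auto)
qed

lemma nbrs_nonempty:
  assumes "u \<in> pverts H" and "v \<in> pverts H" and "u \<noteq> v" and "x \<in> pverts H"
  shows "nbrs H x \<noteq> {}"
proof
  assume x: "nbrs H x = {}"
  have "y = x" if "y \<in> pverts H" for y
    using \<open>x \<in> pverts H\<close> that by (induction rule: walk_induct) (use x in auto)
  with assms show False by metis
qed

lemma sum_laplacian: "(\<Sum>v\<in>pverts H. laplacian H f v) = 0"
proof -
  have "(\<Sum>v\<in>pverts H. laplacian H f v) = (\<Sum>v\<in>pverts H. \<Sum>w\<in>nbrs H v. f v - f w)"
    by (simp add: laplacian_def)
  also have "\<dots> = (\<Sum>v\<in>pverts H. \<Sum>w\<in>nbrs H v. f v) - (\<Sum>v\<in>pverts H. \<Sum>w\<in>nbrs H v. f w)"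
    by (simp add: sum_subtractf)
  also have "\<dots> = 0"
    by (subst sum_nbrs_swap[of "\<lambda>v w. f v"]) simp
  finally show ?thesis .
qed

text \<open>Maximum principle: the set where \<open>f\<close> attains its maximum is closed under adjacency.\<close>

lemma harmonic_constant:
  assumes "\<And>v. v \<in> pverts H \<Longrightarrow> laplacian H f v = 0"
    and "u \<in> pverts H" and "v \<in> pverts H"
  shows "f u = f v"
proof -
  define M where "M = Max (f ` pverts H)"
  have le: "f x \<le> M" if "x \<in> pverts H" for x
    using that finite_verts by (simp add: M_def)
  obtain z where z: "z \<in> pverts H" "f z = M"
    using Max_in[of "f ` pverts H"] verts_nonempty finite_verts unfolding M_def by fastforce
  have "f y = M" if "y \<in> pverts H" for y
    using z(1) that
  proof (induction rule: walk_induct)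
    case (step x y)
    have "(\<Sum>w\<in>nbrs H x. f x - f w) = 0"
      using assms(1)[OF step(1)] by (simp add: laplacian_def)
    moreover have "\<forall>w\<in>nbrs H x. f x - f w \<ge> 0"
      using step le nbrs_subset by auto
    ultimately have "\<forall>w\<in>nbrs H x. f x - f w = 0"
      using finite_nbrs by (subst (asm) sum_nonneg_eq_0_iff) auto
    with step show ?case by auto
  qed (rule z)
  with assms show ?thesis by simp
qed

lemma laplacian_determines:
  assumes "\<And>v. v \<in> pverts H \<Longrightarrow> laplacian H f v = laplacian H g v"
    and "u \<in> pverts H" and "v \<in> pverts H"
  shows "f u - f v = g u - g v"
  using harmonic_constant[of "\<lambda>x. f x - g x" u v] assms by (simp add: laplacian_diff)

end

subsection \<open>Mean first passage times\<close>

lemma prob_rw_path_Suc: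
  assumes "finite (nbrs H v)" and "nbrs H v \<noteq> {}"
  shows "measure_pmf.prob (rw_path H (Suc n) v) A =
    (\<Sum>w\<in>nbrs H v. measure_pmf.prob (rw_path H n w) {xs. v # xs \<in> A}) / deg H v"
proof -
  have "measure_pmf.prob (rw_path H (Suc n) v) A =
      (\<integral>w. measure_pmf.prob (map_pmf ((#) v) (rw_path H n w)) A \<partial>measure_pmf (rw_step H v))"
    unfolding rw_path.simps measure_pmf_bind
    by (subst measure_pmf.measure_bind[where N="count_space UNIV"])
       (auto simp: measure_subprob)
  also have "\<dots> = (\<Sum>w\<in>nbrs H v. measure_pmf.prob (rw_path H n w) {xs. v # xs \<in> A}) / deg H v"
    using assms unfolding rw_step_def nbrs_def[symmetric]
    by (subst integral_pmf_of_set) (auto simp: deg_def vimage_def)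
  finally show ?thesis .
qed

lemma rw_path_nth_0: "xs \<in> set_pmf (rw_path H n v) \<Longrightarrow> xs ! 0 = v"
  by (cases n) auto

lemma first_passage_prob_nonneg: "first_passage_prob H i j n \<ge> 0"
  by (simp add: first_passage_prob_def)

lemma first_passage_prob_Suc:
  assumes "finite (nbrs H i)" and "nbrs H i \<noteq> {}"
  shows "first_passage_prob H i j (Suc n) =
    (if n = 0 then (if j \<in> nbrs H i then 1 else 0)
     else \<Sum>w\<in>nbrs H i - {j}. first_passage_prob H w j n) / deg H i"
proof -
  have shift: "(\<forall>t\<in>{1..<Suc n}. (i # xs) ! t \<noteq> j) \<longleftrightarrow> (\<forall>t\<in>{..<n}. xs ! t \<noteq> j)" for xs
  proof -
    have "{1..<Suc n} = Suc ` {..<n}"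
      by (simp add: lessThan_atLeast0 image_Suc_lessThan)
    then show ?thesis by simp
  qed
  \<comment> \<open>Once the first step has been taken to \<open>w\<close>, avoidance of
    \<open>j\<close> starts at time 0 of the remaining path and so concerns \<open>w\<close> itself:
    \<open>w = j\<close> contributes exactly when \<open>n = 0\<close>.\<close>
  have step: "measure_pmf.prob (rw_path H n w) {xs. xs ! n = j \<and> (\<forall>t\<in>{..<n}. xs ! t \<noteq> j)} =
      (if n = 0 then (if w = j then 1 else 0)
       else if w = j then 0 else first_passage_prob H w j n)" for w
  proof (cases "n = 0")
    case True
    then show ?thesis by (simp add: indicator_def)
  next
    case False
    have split: "{..<n} = insert 0 {1..<n}" using False by auto
    have "measure_pmf.prob (rw_path H n w) {xs. xs ! n = j \<and> (\<forall>t\<in>{..<n}. xs ! t \<noteq> j)} =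
       measure_pmf.prob (rw_path H n w)
         (if w = j then {} else {xs. n \<ge> 1 \<and> xs ! n = j \<and> (\<forall>t\<in>{1..<n}. xs ! t \<noteq> j)})"
      using False unfolding split
      by (intro measure_pmf.finite_measure_eq_AE) (auto simp: AE_measure_pmf_iff rw_path_nth_0)
    then show ?thesis using False by (simp add: first_passage_prob_def)
  qed
  have "first_passage_prob H i j (Suc n) = (\<Sum>w\<in>nbrs H i. measure_pmf.prob (rw_path H n w)
      {xs. xs ! n = j \<and> (\<forall>t\<in>{..<n}. xs ! t \<noteq> j)}) / deg H i"
    unfolding first_passage_prob_def prob_rw_path_Suc[OF assms]
    using shift by simp
  also have "(\<Sum>w\<in>nbrs H i. measure_pmf.prob (rw_path H n w)
      {xs. xs ! n = j \<and> (\<forall>t\<in>{..<n}. xs ! t \<noteq> j)}) =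
      (if n = 0 then (if j \<in> nbrs H i then 1 else 0)
       else \<Sum>w\<in>nbrs H i - {j}. first_passage_prob H w j n)"
    unfolding step using assms(1)
    by (auto intro!: sum.mono_neutral_cong_right split: if_splits)
  finally show ?thesis .
qed

text \<open>The probability that the walk from \<open>i\<close> avoids \<open>j\<close> at the times \<open>1, \<dots>, n\<close>.\<close>

primrec survival :: "'a pair_pre_digraph \<Rightarrow> 'a \<Rightarrow> nat \<Rightarrow> 'a \<Rightarrow> real" where
  "survival H j 0 = (\<lambda>i. 1)"
| "survival H j (Suc n) = (\<lambda>i. (\<Sum>w\<in>nbrs H i - {j}. survival H j n w) / deg H i)"

lemma survival_nonneg: "survival H j n i \<ge> 0"
  by (induction n arbitrary: i) (auto intro!: sum_nonneg divide_nonneg_nonneg simp: deg_def)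

context conn_graph
begin

context
  fixes j
  assumes j: "j \<in> pverts H" and nontrivial: "\<exists>i\<in>pverts H. i \<noteq> j"
begin

lemma nbrs_ne: "i \<in> pverts H \<Longrightarrow> nbrs H i \<noteq> {}"
  using nontrivial j nbrs_nonempty by metis

lemma deg_pos: "i \<in> pverts H \<Longrightarrow> deg H i > 0"
  using nbrs_ne deg_pos_iff by blast

text \<open>
  Kac's argument: in total mass against the stationary measure, the survival probabilities lose
  exactly \<open>deg j * survival j\<close> in each step.
\<close>

lemma summable_survival_self: "summable (\<lambda>n. survival H j n j)"
proof -
  define a where "a n = (\<Sum>i\<in>pverts H. deg H i * survival H j n i)" for n
  have a_Suc: "a (Suc n) = a n - deg H j * survival H j n j" for n
  proof -
    have "a (Suc n) = (\<Sum>i\<in>pverts H. \<Sum>w\<in>nbrs H i - {j}. survival H j n w)"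
      unfolding a_def using deg_pos by (intro sum.cong) (auto dest!: deg_pos)
    also have "\<dots> = (\<Sum>i\<in>pverts H. \<Sum>w\<in>nbrs H i. if w = j then 0 else survival H j n w)"
      using finite_nbrs by (intro sum.cong[OF refl] sum.mono_neutral_cong_left) auto
    also have "\<dots> = (\<Sum>i\<in>pverts H. \<Sum>w\<in>nbrs H i. if i = j then 0 else survival H j n i)"
      by (rule sum_nbrs_swap)
    also have "\<dots> = (\<Sum>i\<in>pverts H. if i = j then 0 else deg H i * survival H j n i)"
      by (intro sum.cong) (auto simp: deg_def)
    also have "\<dots> = (\<Sum>i\<in>pverts H - {j}. deg H i * survival H j n i)"
      using finite_verts by (intro sum.mono_neutral_cong_right) auto
    also have "\<dots> = a n - deg H j * survival H j n j"
      using finite_verts j by (simp add: a_def sum_diff1)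
    finally show ?thesis .
  qed
  have "deg H j * (\<Sum>n<N. survival H j n j) = a 0 - a N" for N
    by (induction N) (auto simp: a_Suc algebra_simps)
  moreover have "a N \<ge> 0" for N
    unfolding a_def by (intro sum_nonneg mult_nonneg_nonneg deg_nonneg survival_nonneg)
  ultimately have "deg H j * (\<Sum>n<N. survival H j n j) \<le> a 0" for N
    by (metis diff_le_eq le_add_same_cancel1)
  then have "(\<Sum>n<N. survival H j n j) \<le> a 0 / deg H j" for N
    using deg_pos[OF j] by (simp add: pos_le_divide_eq mult.commute)
  then show ?thesis
    by (intro summableI_nonneg_bounded survival_nonneg)
qed

text \<open>Convergence spreads from \<open>j\<close> along edges: the walk from \<open>x\<close>
  moves to a neighbour \<open>y\<close> with probability 1 / deg x, so for \<open>y\<close> other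
  than \<open>j\<close> survival from \<open>y\<close> is at most deg x times survival from
  \<open>x\<close> for one more step.\<close>

lemma summable_survival:
  assumes "i \<in> pverts H"
  shows "summable (\<lambda>n. survival H j n i)"
  using j assms
proof (induction rule: walk_induct)
  case base
  show ?case by (rule summable_survival_self)
next
  case (step x y)
  show ?case
  proof (cases "y = j")
    case True
    then show ?thesis by (simp add: summable_survival_self)
  next
    case False
    have "norm (survival H j n y) \<le> deg H x * survival H j (Suc n) x" for n
    proof -
      have "survival H j n y \<le> (\<Sum>w\<in>nbrs H x - {j}. survival H j n w)"
        using step False finite_nbrs by (intro member_le_sum survival_nonneg) auto
      then show ?thesis using deg_pos[OF step(1)] survival_nonneg[of H j n y] by simp
    qed
    moreover have "summable (\<lambda>n. deg H x * survival H j (Suc n) x)"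
      by (rule summable_mult, rule iffD2[OF summable_Suc_iff]) (rule step(3))
    ultimately show ?thesis
      by (meson summable_comparison_test)
  qed
qed

text \<open>Both sides obey the same first step recursion, so \<open>survival\<close> need not be
  realised as an event on paths.\<close>

lemma first_passage_prob_survival:
  "i \<in> pverts H \<Longrightarrow> first_passage_prob H i j (Suc n) = survival H j n i - survival H j (Suc n) i"
proof (induction n arbitrary: i)
  case 0
  have "card (nbrs H i - {j}) = card (nbrs H i) - (if j \<in> nbrs H i then 1 else 0)"
    using finite_nbrs by (simp add: card_Diff_singleton_if)
  moreover have "j \<in> nbrs H i \<Longrightarrow> card (nbrs H i) \<ge> 1"
    using finite_nbrs by (auto simp: Suc_le_eq card_gt_0_iff)
  ultimately have "real (card (nbrs H i - {j})) = deg H i - (if j \<in> nbrs H i then 1 else 0)"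
    by (auto simp: deg_def of_nat_diff)
  then show ?case
    using deg_pos[OF 0] nbrs_ne[OF 0] finite_nbrs by (simp add: first_passage_prob_Suc field_simps)
next
  case (Suc n)
  have "first_passage_prob H w j (Suc n) = survival H j n w - survival H j (Suc n) w"
    if "w \<in> nbrs H i - {j}" for w
    using Suc.IH that nbrs_subset by blast
  then show ?case
    unfolding survival.simps(2)[of H j "Suc n"] survival.simps(2)[of H j n]
    using nbrs_ne[OF Suc.prems] finite_nbrs
    by (simp add: first_passage_prob_Suc[of H i j "Suc n"] sum_subtractf diff_divide_distrib
        del: survival.simps(2))
qed

text \<open>Almost sure finiteness of the passage time: the series telescopes, and summable survival
  probabilities tend to 0.\<close>

lemma first_passage_prob_sums_1:
  assumes "i \<in> pverts H"
  shows "(\<lambda>n. first_passage_prob H i j (Suc n)) sums 1"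
proof -
  have "(\<lambda>n. survival H j n i) \<longlonglongrightarrow> 0"
    using summable_survival[OF assms] by (rule summable_LIMSEQ_zero)
  from telescope_sums'[OF this] show ?thesis
    by (simp add: first_passage_prob_survival[OF assms] del: survival.simps(2))
qed

lemma summable_mfpt:
  assumes "i \<in> pverts H"
  shows "summable (\<lambda>n. real n * first_passage_prob H i j n)"
proof -
  \<comment> \<open>Summation by parts, the finite form of E T = sum of P (T > n); the boundary term
    has the sign that gives an upper bound.\<close>
  have eq: "(\<Sum>n<N. real (Suc n) * first_passage_prob H i j (Suc n)) =
      (\<Sum>n<N. survival H j n i) - real N * survival H j N i" for N
    by (induction N)
       (simp_all add: first_passage_prob_survival[OF assms] algebra_simps del: survival.simps(2))
  have "(\<Sum>n<N. real (Suc n) * first_passage_prob H i j (Suc n))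
      \<le> (\<Sum>n. survival H j n i)" for N
  proof -
    have "(\<Sum>n<N. survival H j n i) \<le> (\<Sum>n. survival H j n i)"
      using summable_survival[OF assms] survival_nonneg by (intro sum_le_suminf) auto
    moreover have "real N * survival H j N i \<ge> 0"
      by (simp add: survival_nonneg)
    ultimately show ?thesis unfolding eq by linarith
  qed
  then have "summable (\<lambda>n. real (Suc n) * first_passage_prob H i j (Suc n))"
    by (rule summableI_nonneg_bounded[rotated]) (simp add: first_passage_prob_nonneg)
  then show ?thesis
    using summable_Suc_iff[of "\<lambda>n. real n * first_passage_prob H i j n"] by simp
qed

lemma mfpt_first_step:
  assumes i: "i \<in> pverts H"
  shows "mfpt H i j = 1 + (\<Sum>w\<in>nbrs H i - {j}. mfpt H w j) / deg H i"
proof -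
  let ?f = "\<lambda>i n. first_passage_prob H i j n"
  have w: "w \<in> pverts H" if "w \<in> nbrs H i - {j}" for w
    using that nbrs_subset by blast
  have 1: "(\<lambda>n. \<Sum>w\<in>nbrs H i - {j}. real n * ?f w n) sums (\<Sum>w\<in>nbrs H i - {j}. mfpt H w j)"
    unfolding mfpt_def using summable_mfpt w by (intro sums_sum summable_sums) auto
  have 2: "(\<lambda>n. ?f i (Suc n) + (\<Sum>w\<in>nbrs H i - {j}. real n * ?f w n) / deg H i)
      sums (1 + (\<Sum>w\<in>nbrs H i - {j}. mfpt H w j) / deg H i)"
    by (intro sums_add sums_divide first_passage_prob_sums_1 1 i)
  \<comment> \<open>The recursion for \<open>Suc n\<close> is weighted by \<open>n\<close>, which
    removes its exceptional case \<open>n = 0\<close>; the remaining copy of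
    \<open>?f i (Suc n)\<close> sums to the 1 of the first step.\<close>
  have "?f i (Suc n) + (\<Sum>w\<in>nbrs H i - {j}. real n * ?f w n) / deg H i = real (Suc n) * ?f i (Suc n)"
    for n
    using nbrs_ne[OF i] finite_nbrs unfolding sum_distrib_left[symmetric]
    by (cases "n = 0") (auto simp: first_passage_prob_Suc add_divide_distrib[symmetric] distrib_right)
  with 2 have "(\<lambda>n. real (Suc n) * ?f i (Suc n))
      sums (1 + (\<Sum>w\<in>nbrs H i - {j}. mfpt H w j) / deg H i)"
    by simp
  then have "(\<lambda>n. real n * ?f i n) sums (1 + (\<Sum>w\<in>nbrs H i - {j}. mfpt H w j) / deg H i)"
    using sums_Suc_iff[of "\<lambda>n. real n * ?f i n"] by simp
  then show ?thesis by (simp add: mfpt_def sums_iff)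
qed

end

end

section \<open>Hitting times as potentials, effective resistance and Kemeny's constant\<close>

text \<open>On the diagonal \<open>mfpt\<close> is a mean return time; a potential grounded at the
  target has to vanish there.\<close>

definition hit :: "'a pair_pre_digraph \<Rightarrow> 'a \<Rightarrow> 'a \<Rightarrow> real" where
  "hit H u v = (if u = v then 0 else mfpt H u v)"

text \<open>
  The effective resistance, by the commute time identity; it is the potential difference produced
  by a unit current (\<open>resistance_eq_potential_diff\<close> below). For a graph without edges it is
  \<open>0 / 0 = 0\<close>, which is the right value.
\<close>

definition resistance :: "'a pair_pre_digraph \<Rightarrow> 'a \<Rightarrow> 'a \<Rightarrow> real" where
  "resistance H u v = (hit H u v + hit H v u) / (2 * real (num_edges H))"

lemma hit_self [simp]: "hit H u u = 0"
  by (simp add: hit_def)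

lemma resistance_sym: "resistance H u v = resistance H v u"
  by (simp add: resistance_def add.commute)

context conn_graph
begin

lemma laplacian_hit_neq:
  assumes "u \<in> pverts H" and "v \<in> pverts H" and "u \<noteq> v"
  shows "laplacian H (\<lambda>x. hit H x v) u = deg H u"
proof -
  have nt: "\<exists>i\<in>pverts H. i \<noteq> v" using assms by auto
  have d: "deg H u > 0" using deg_pos[OF assms(2) nt assms(1)] .
  have "laplacian H (\<lambda>x. hit H x v) u = deg H u * hit H u v - (\<Sum>w\<in>nbrs H u. hit H w v)"
    by (simp add: laplacian_def sum_subtractf deg_def)
  also have "(\<Sum>w\<in>nbrs H u. hit H w v) = (\<Sum>w\<in>nbrs H u - {v}. mfpt H w v)"
    using finite_nbrs by (intro sum.mono_neutral_cong_right) (auto simp: hit_def)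
  also have "deg H u * hit H u v = deg H u + (\<Sum>w\<in>nbrs H u - {v}. mfpt H w v)"
    using assms d by (simp add: hit_def mfpt_first_step[OF assms(2) nt assms(1)] field_simps)
  finally show ?thesis by simp
qed

text \<open>The value at the target is forced without computing a return time: a Laplacian sums to 0
  over the graph, and the degrees sum to 2m.\<close>

lemma laplacian_hit:
  assumes "u \<in> pverts H" and "v \<in> pverts H"
  shows "laplacian H (\<lambda>x. hit H x v) u = deg H u - (if u = v then 2 * real (num_edges H) else 0)"
proof (cases "u = v")
  case True
  let ?L = "laplacian H (\<lambda>x. hit H x v)"
  have "(\<Sum>x\<in>pverts H - {v}. ?L x) = (\<Sum>x\<in>pverts H - {v}. deg H x)"
    using assms by (intro sum.cong) (auto simp: laplacian_hit_neq)
  moreover have "(\<Sum>x\<in>pverts H. ?L x) = ?L v + (\<Sum>x\<in>pverts H - {v}. ?L x)"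
    "(\<Sum>x\<in>pverts H. deg H x) = deg H v + (\<Sum>x\<in>pverts H - {v}. deg H x)"
    using assms finite_verts by (auto intro: sum.remove)
  ultimately have "?L v = deg H v - 2 * real (num_edges H)"
    using sum_laplacian[of "\<lambda>x. hit H x v"] sum_deg by linarith
  with True show ?thesis by simp
qed (use assms laplacian_hit_neq in auto)

text \<open>The sources \<open>deg\<close> of the two hitting-time functions cancel, leaving 2m at
  \<open>a\<close> and -2m at \<open>b\<close>; the divisor normalises this to a unit
  current.\<close>

definition potential :: "'a \<Rightarrow> 'a \<Rightarrow> 'a \<Rightarrow> real" where
  "potential a b x = (hit H x b - hit H x a) / (2 * real (num_edges H))"

lemma laplacian_potential:
  assumes "a \<in> pverts H" and "b \<in> pverts H" and "x \<in> pverts H"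
  shows "laplacian H (potential a b) x = (if x = a then 1 else 0) - (if x = b then 1 else 0)"
proof (cases "num_edges H = 0")
  \<comment> \<open>A connected graph without edges has a single vertex, so \<open>a = b\<close>,
    and division by zero yields the potential 0 that is wanted.\<close>
  case True
  then have "a = b" using num_edges_eq_0D assms by blast
  moreover have "potential a b = (\<lambda>_. 0)" using True by (simp add: potential_def fun_eq_iff)
  ultimately show ?thesis by (simp add: laplacian_def)
next
  case False
  have "laplacian H (potential a b) x =
      (laplacian H (\<lambda>x. hit H x b) x - laplacian H (\<lambda>x. hit H x a) x) / (2 * real (num_edges H))"
    unfolding potential_def laplacian_divide laplacian_diff ..
  with False show ?thesis
    using assms by (auto simp: laplacian_hit)
qed

lemma potential_diff: "potential a b a - potential a b b = resistance H a b"
  by (simp add: potential_def resistance_def add_divide_distrib)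

lemma resistance_eq_potential_diff:
  assumes "a \<in> pverts H" and "b \<in> pverts H"
    and "\<And>x. x \<in> pverts H \<Longrightarrow>
      laplacian H f x = (if x = a then 1 else 0) - (if x = b then 1 else 0)"
  shows "resistance H a b = f a - f b"
proof -
  have "f a - f b = potential a b a - potential a b b"
    by (rule laplacian_determines) (use assms in \<open>simp_all add: laplacian_potential\<close>)
  then show ?thesis by (simp add: potential_diff)
qed

lemma stationary_eq: "stationary H v = deg H v / (2 * real (num_edges H))"
proof -
  have "out_arcs (with_proj H) v = Pair v ` nbrs H v"
    by (auto simp: nbrs_def)
  then show ?thesis
    by (simp add: stationary_def out_degree_def deg_def card_image inj_on_def)
qed

lemma sum_stationary_hit:
  "(\<Sum>j\<in>pverts H - {i}. stationary H j * mfpt H i j) = (\<Sum>j\<in>pverts H. stationary H j * hit H i j)"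
  "(\<Sum>j\<in>pverts H - {i}. stationary H j * mfpt H j i) = (\<Sum>j\<in>pverts H. stationary H j * hit H j i)"
  by (rule sum.mono_neutral_cong_left; use finite_verts in \<open>simp add: hit_def; fastforce\<close>)+

text \<open>As a function of the starting vertex the sum is harmonic: the sources contribute 2m deg
  x in total, and the sink for the target \<open>x\<close> takes away the same amount. This makes
  the \<open>THE\<close> in \<open>kemeny\<close> well defined.\<close>

lemma sum_deg_hit_constant:
  assumes "u \<in> pverts H" and "v \<in> pverts H"
  shows "(\<Sum>j\<in>pverts H. deg H j * hit H u j) = (\<Sum>j\<in>pverts H. deg H j * hit H v j)"
  using assms
proof (rule harmonic_constant[rotated])
  fix x assume x: "x \<in> pverts H"
  have "laplacian H (\<lambda>x. \<Sum>j\<in>pverts H. deg H j * hit H x j) x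
      = (\<Sum>w\<in>nbrs H x. \<Sum>j\<in>pverts H. deg H j * (hit H x j - hit H w j))"
    by (simp add: laplacian_def sum_subtractf right_diff_distrib)
  also have "\<dots> = (\<Sum>j\<in>pverts H. deg H j * laplacian H (\<lambda>y. hit H y j) x)"
    by (subst sum.swap) (simp add: laplacian_def sum_distrib_left)
  also have "\<dots> = (\<Sum>j\<in>pverts H. deg H j * deg H x -
      (if j = x then deg H j * (2 * real (num_edges H)) else 0))"
    using x by (intro sum.cong) (auto simp: laplacian_hit algebra_simps)
  also have "\<dots> = (\<Sum>j\<in>pverts H. deg H j) * deg H x - deg H x * (2 * real (num_edges H))"
    using x finite_verts by (simp add: sum_subtractf sum_distrib_right)
  also have "\<dots> = 0" by (simp add: sum_deg)
  finally show "laplacian H (\<lambda>x. \<Sum>j\<in>pverts H. deg H j * hit H x j) x = 0" .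
qed

lemma sum_stationary_hit_eq:
  "(\<Sum>j\<in>pverts H. stationary H j * hit H i j) =
     (\<Sum>j\<in>pverts H. deg H j * hit H i j) / (2 * real (num_edges H))"
  "(\<Sum>j\<in>pverts H. stationary H j * hit H j i) =
     (\<Sum>j\<in>pverts H. deg H j * hit H j i) / (2 * real (num_edges H))"
  by (simp_all add: stationary_eq sum_divide_distrib)

lemma kemeny_eq:
  assumes "i \<in> pverts H"
  shows "kemeny H = (\<Sum>j\<in>pverts H. deg H j * hit H i j) / (2 * real (num_edges H))"
  unfolding kemeny_def sum_stationary_hit sum_stationary_hit_eq
  using assms sum_deg_hit_constant by (intro the_equality) metis+

lemma accessibility_index_eq:
  "accessibility_index H v = (\<Sum>j\<in>pverts H. deg H j * hit H j v) / (2 * real (num_edges H))"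
  unfolding accessibility_index_def sum_stationary_hit sum_stationary_hit_eq ..

lemma sum_deg_resistance:
  assumes "v \<in> pverts H"
  shows "(\<Sum>u\<in>pverts H. deg H u * resistance H u v) = accessibility_index H v + kemeny H"
  unfolding accessibility_index_eq kemeny_eq[OF assms] resistance_def
    add_divide_distrib[symmetric] sum.distrib[symmetric]
  by (simp add: sum_divide_distrib distrib_left)

text \<open>Either order of the hitting times contributes 2m times 2m kappa, and
  \<open>resistance\<close> divides by 2m; hence the factor 4.\<close>

lemma sum_deg_deg_resistance:
  "(\<Sum>u\<in>pverts H. \<Sum>v\<in>pverts H. deg H u * deg H v * resistance H u v)
     = 4 * real (num_edges H) * kemeny H"
proof (cases "num_edges H = 0")
  case True
  then show ?thesis by (simp add: resistance_def)
next
  case False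
  have "(\<Sum>u\<in>pverts H. \<Sum>v\<in>pverts H. deg H u * deg H v * hit H u v)
      = (\<Sum>u\<in>pverts H. deg H u * (\<Sum>v\<in>pverts H. deg H v * hit H u v))"
    by (simp add: sum_distrib_left mult.assoc)
  also have "\<dots> = (\<Sum>u\<in>pverts H. deg H u * (2 * real (num_edges H) * kemeny H))"
    using False by (intro sum.cong) (auto simp: kemeny_eq)
  also have "\<dots> = 2 * real (num_edges H) * (2 * real (num_edges H) * kemeny H)"
    by (simp add: sum_distrib_right[symmetric] sum_deg)
  finally have 1: "(\<Sum>u\<in>pverts H. \<Sum>v\<in>pverts H. deg H u * deg H v * hit H u v)
      = 2 * real (num_edges H) * (2 * real (num_edges H) * kemeny H)" .
  have 2: "(\<Sum>u\<in>pverts H. \<Sum>v\<in>pverts H. deg H u * deg H v * hit H v u)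
      = 2 * real (num_edges H) * (2 * real (num_edges H) * kemeny H)"
    unfolding 1[symmetric] by (subst sum.swap) (simp add: mult.commute)
  have "(\<Sum>u\<in>pverts H. \<Sum>v\<in>pverts H. deg H u * deg H v * resistance H u v) =
      ((\<Sum>u\<in>pverts H. \<Sum>v\<in>pverts H. deg H u * deg H v * hit H u v)
     + (\<Sum>u\<in>pverts H. \<Sum>v\<in>pverts H. deg H u * deg H v * hit H v u)) / (2 * real (num_edges H))"
    by (simp add: resistance_def sum.distrib[symmetric] sum_divide_distrib distrib_left)
  also have "\<dots> = 4 * real (num_edges H) * kemeny H"
    unfolding 1 2 using False by (simp add: field_simps)
  finally show ?thesis .
qed

end

subsection \<open>Removing an edge from a tree\<close>

definition side :: "'b pair_pre_digraph \<Rightarrow> 'b \<Rightarrow> 'b \<Rightarrow> 'b set" where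
  "side T i j = {l. (i, l) \<in> (parcs T - {(i, j), (j, i)})\<^sup>*}"

lemma side_self: "i \<in> side T i j"
  by (simp add: side_def)

locale finite_tree =
  fixes T :: "'b pair_pre_digraph"
  assumes tree_graph: "tree_graph T"

sublocale finite_tree \<subseteq> conn_graph T
  using tree_graph by unfold_locales (simp add: tree_graph_def)

context finite_tree
begin

lemma sym_parcs_minus: "sym (parcs T - {(i, j), (j, i)})"
  using sym_parcs by (auto simp: sym_def)

lemma side_subset:
  assumes "i \<in> pverts T"
  shows "side T i j \<subseteq> pverts T"
proof
  fix l assume "l \<in> side T i j"
  then have "(i, l) \<in> (parcs T - {(i, j), (j, i)})\<^sup>*" by (simp add: side_def)
  then show "l \<in> pverts T"
    using assms parcs_subset by (induction rule: rtrancl_induct) auto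
qed

lemma side_closed:
  assumes "(x, y) \<in> parcs T" and "(x, y) \<noteq> (i, j)" and "(x, y) \<noteq> (j, i)"
  shows "x \<in> side T i j \<longleftrightarrow> y \<in> side T i j"
proof -
  have xy: "(x, y) \<in> parcs T - {(i, j), (j, i)}" using assms by auto
  then have "(y, x) \<in> parcs T - {(i, j), (j, i)}"
    using sym_parcs_minus by (meson symD)
  with xy show ?thesis by (auto simp: side_def intro: rtrancl_into_rtrancl)
qed

lemma side_Un:
  assumes "(i, j) \<in> parcs T"
  shows "side T i j \<union> side T j i = pverts T"
proof
  have ij: "i \<in> pverts T" "j \<in> pverts T" using assms parcs_subset by auto
  then show "side T i j \<union> side T j i \<subseteq> pverts T" using side_subset by blast
  show "pverts T \<subseteq> side T i j \<union> side T j i"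
  proof
    fix l assume "l \<in> pverts T"
    with ij(1) show "l \<in> side T i j \<union> side T j i"
    proof (induction rule: walk_induct)
      case base
      then show ?case by (simp add: side_self)
    next
      case (step x y)
      then have "(x, y) \<in> parcs T" by (simp add: nbrs_def)
      then show ?case
        using step side_closed[of x y i j] side_closed[of x y j i] side_self[of i T j] side_self[of j T i]
        by auto
    qed
  qed
qed

text \<open>This is where acyclicity enters: a vertex on both sides yields a simple path from
  \<open>i\<close> to \<open>j\<close> that avoids the edge, and the edge closes it to a
  cycle.\<close>

lemma side_disjoint:
  assumes ij: "(i, j) \<in> parcs T"
  shows "side T i j \<inter> side T j i = {}"
proof (rule ccontr)
  assume "side T i j \<inter> side T j i \<noteq> {}"
  then obtain l where "(i, l) \<in> (parcs T - {(i, j), (j, i)})\<^sup>*" "(j, l) \<in> (parcs T - {(i, j), (j, i)})\<^sup>*"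
    by (auto simp: side_def insert_commute)
  then have path: "(i, j) \<in> (parcs T - {(i, j), (j, i)})\<^sup>*"
    using sym_rtrancl[OF sym_parcs_minus[of i j]] by (meson rtrancl_trans symD)
  let ?D = "del_edge T i j"
  have D: "pair_wf_digraph ?D"
    using parcs_subset by unfold_locales (auto simp: del_edge_def)
  interpret D: pair_wf_digraph ?D by (fact D)
  interpret T: pair_graph T using connected_graph by (simp add: connected_graph_def)
  have i: "i \<in> pverts T" and ne: "i \<noteq> j"
    using ij parcs_subset irrefl_parcs by (auto simp: irrefl_def)
  have "reachable (with_proj ?D) i j"
    using path i by (subst D.reachable_conv') (auto simp: del_edge_def)
  then obtain p where p: "D.apath i p j"
    by (auto simp: D.reachable_apath)
  then have "set p \<subseteq> parcs ?D" and cas: "pcas i p j" and dist: "distinct (pawalk_verts i p)"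
    by (auto simp: D.apath_def D.awalk_def)
  then have pD: "set p \<subseteq> parcs T - {(i, j), (j, i)}"
    by (simp add: del_edge_def)
  \<comment> \<open>With the closing arc this reaches the length 3 demanded by
    \<open>tree_graph\<close>: the path is not empty as the ends differ, and its only arc cannot be
    the deleted one.\<close>
  have "length p \<ge> 2"
  proof (rule ccontr)
    assume "\<not> length p \<ge> 2"
    then consider "p = []" | e where "p = [e]"
      by (cases p; cases "tl p") auto
    then show False using cas pD ne by cases auto
  qed
  moreover have "T.cycle ((j, i) # p)"
  proof -
    have "(j, i) \<in> parcs T" using ij sym_parcs by (meson symD)
    then have "T.awalk j ((j, i) # p) j"
      using pD cas parcs_subset by (auto simp: T.awalk_def)
    then show ?thesis using dist by (auto simp: T.cycle_def)
  qed
  ultimately show False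
    using tree_graph by (fastforce simp: tree_graph_def)
qed

lemma side_iff:
  assumes "(i, j) \<in> parcs T" and "l \<in> pverts T"
  shows "l \<in> side T j i \<longleftrightarrow> l \<notin> side T i j"
  using side_Un[OF assms(1)] side_disjoint[OF assms(1)] assms(2) by blast

lemma ex1_branch:
  assumes "i \<in> pverts T" and "l \<in> pverts T" and "l \<noteq> i"
  shows "\<exists>!j. j \<in> nbrs T i \<and> l \<in> side T j i"
proof (rule ex_ex1I)
  have "l = i \<or> (\<exists>j. j \<in> nbrs T i \<and> l \<in> side T j i)"
    using assms(1,2)
  proof (induction rule: walk_induct)
    case (step x y)
    show ?case
    proof (cases "x = i")
      case True
      then show ?thesis using step side_self[of y T i] by auto
    next
      case False
      then obtain j where j: "j \<in> nbrs T i" "x \<in> side T j i" using step by auto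
      have "(x, y) \<in> parcs T" using step by (simp add: nbrs_def)
      then show ?thesis
        using j False side_closed[of x y j i] side_self[of j T i] by auto
    qed
  qed simp
  with assms show "\<exists>j. j \<in> nbrs T i \<and> l \<in> side T j i" by blast
next
  fix j j'
  assume j: "j \<in> nbrs T i \<and> l \<in> side T j i" and j': "j' \<in> nbrs T i \<and> l \<in> side T j' i"
  show "j = j'"
  proof (rule ccontr)
    assume ne: "j \<noteq> j'"
    have ij: "(i, j) \<in> parcs T" "(i, j') \<in> parcs T" using j j' by (auto simp: nbrs_def)
    have i_notin: "i \<notin> side T j i"
      using side_disjoint[OF ij(1)] side_self[of i T j] by blast
    have "(j, l) \<in> (parcs T - {(j, i), (i, j)})\<^sup>*" using j by (simp add: side_def)
    \<comment> \<open>A path on the side of \<open>j\<close> never returns to \<open>i\<close>,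
      hence never uses the edge to \<open>j'\<close>; prolonged by the edge from \<open>i\<close> to
      \<open>j\<close>, it stays on the side of \<open>i\<close> opposite to
      \<open>j'\<close>.\<close>
    then have "l \<in> side T j i \<and> l \<in> side T i j'"
    proof (induction rule: rtrancl_induct)
      case base
      then show ?case
        using side_closed[OF ij(1), of i j'] ne ij irrefl_parcs side_self[of i T j'] side_self[of j T i]
        by (auto simp: irrefl_def)
    next
      case (step y z)
      then have "z \<in> side T j i"
        unfolding side_def mem_Collect_eq by (meson rtrancl_into_rtrancl)
      moreover have "y \<noteq> i" using step i_notin by blast
      ultimately show ?case
        using side_closed[of y z i j'] i_notin step by auto
    qed
    with j' side_disjoint[OF ij(2)] show False by blast
  qed
qed

end

subsection \<open>Chains\<close>

lemma sum_swap3: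
  "(\<Sum>u\<in>A. \<Sum>v\<in>B. \<Sum>i\<in>I. f u v i) = (\<Sum>i\<in>I. \<Sum>u\<in>A. \<Sum>v\<in>B. f u v i)"
proof -
  have "(\<Sum>u\<in>A. \<Sum>v\<in>B. \<Sum>i\<in>I. f u v i) = (\<Sum>u\<in>A. \<Sum>i\<in>I. \<Sum>v\<in>B. f u v i)"
    by (intro sum.cong refl sum.swap)
  also have "\<dots> = (\<Sum>i\<in>I. \<Sum>u\<in>A. \<Sum>v\<in>B. f u v i)"
    by (rule sum.swap)
  finally show ?thesis .
qed

locale graph_chain = T: finite_tree T for T :: "nat pair_pre_digraph" +
  fixes Gs :: "nat \<Rightarrow> 'a pair_pre_digraph" and c :: "nat \<Rightarrow> nat \<Rightarrow> 'a"
  assumes connected_part: "i \<in> pverts T \<Longrightarrow> connected_graph (Gs i)"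
    and disjoint_parts: "disjoint_family_on (\<lambda>i. pverts (Gs i)) (pverts T)"
    and c_in_part: "(i, j) \<in> parcs T \<Longrightarrow> c i j \<in> pverts (Gs i)"
begin

abbreviation G :: "'a pair_pre_digraph" where
  "G \<equiv> chain T Gs c"

lemma conn_graph_part: "i \<in> pverts T \<Longrightarrow> conn_graph (Gs i)"
  by (simp add: conn_graph_def connected_part)

lemma pverts_G: "pverts G = (\<Union>i\<in>pverts T. pverts (Gs i))"
  by (simp add: chain_def)

lemma in_pverts_G: "i \<in> pverts T \<Longrightarrow> u \<in> pverts (Gs i) \<Longrightarrow> u \<in> pverts G"
  by (auto simp: pverts_G)

lemma part_unique:
  "i \<in> pverts T \<Longrightarrow> j \<in> pverts T \<Longrightarrow> u \<in> pverts (Gs i) \<Longrightarrow> u \<in> pverts (Gs j) \<Longrightarrow> i = j"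
  using disjoint_parts by (auto simp: disjoint_family_on_def)

definition part :: "'a \<Rightarrow> nat" where
  "part u = (THE l. l \<in> pverts T \<and> u \<in> pverts (Gs l))"

lemma part_eq: "l \<in> pverts T \<Longrightarrow> u \<in> pverts (Gs l) \<Longrightarrow> part u = l"
  unfolding part_def using part_unique by (intro the_equality) auto

lemma part_of_eq: "l \<in> pverts T \<Longrightarrow> u \<in> pverts (Gs l) \<Longrightarrow> part_of T Gs u = Gs l"
  using part_eq by (simp add: part_of_def part_def)

lemma part_in:
  assumes "u \<in> pverts G"
  shows "part u \<in> pverts T" and "u \<in> pverts (Gs (part u))"
  using assms part_eq by (auto simp: pverts_G)

lemma parcs_T_sym: "(i, j) \<in> parcs T \<Longrightarrow> (j, i) \<in> parcs T"
  using T.sym_parcs by (meson symD)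

lemma parcs_T_verts:
  assumes "(i, j) \<in> parcs T"
  shows "i \<in> pverts T" and "j \<in> pverts T" and "i \<noteq> j"
  using assms T.parcs_subset T.irrefl_parcs by (auto simp: irrefl_def)

lemma part_c: "(i, j) \<in> parcs T \<Longrightarrow> part (c i j) = i"
  using part_eq c_in_part parcs_T_verts by blast

lemma parcs_part:
  assumes "i \<in> pverts T" and "(u, w) \<in> parcs (Gs i)"
  shows "u \<in> pverts (Gs i)" and "w \<in> pverts (Gs i)"
  using conn_graph.parcs_subset[OF conn_graph_part[OF assms(1)]] assms(2) by auto

lemma in_parcs_G:
  "(u, w) \<in> parcs G \<longleftrightarrow> (\<exists>i\<in>pverts T. (u, w) \<in> parcs (Gs i)) \<or>
     (\<exists>i j. (i, j) \<in> parcs T \<and> u = c i j \<and> w = c j i)"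
  by (auto simp: chain_def)

text \<open>A bridge remembers its tree edge, because the parts containing its ends are the ends of
  that edge.\<close>

lemma bridge_arc_eq:
  assumes "(i, j) \<in> parcs T" and "(a, b) \<in> parcs T" and "c a b = c i j" and "c b a = c j i"
  shows "a = i" and "b = j"
  using assms part_c parcs_T_sym by metis+

lemma part_path:
  assumes "i \<in> pverts T" and "u \<in> pverts (Gs i)" and "v \<in> pverts (Gs i)"
    and "parcs (Gs i) \<subseteq> r"
  shows "(u, v) \<in> r\<^sup>*"
  using conn_graph.path_exists[OF conn_graph_part[OF assms(1)] assms(2,3)] assms(4) rtrancl_mono
  by blast

lemma connected_graph_G: "connected_graph G"
  unfolding connected_graph_iff
proof (intro conjI ballI)
  show "pverts G \<noteq> {}"
    using T.verts_nonempty conn_graph.verts_nonempty[OF conn_graph_part] by (auto simp: pverts_G)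
  show "finite (pverts G)"
    using T.finite_verts conn_graph.finite_verts[OF conn_graph_part] by (auto simp: pverts_G)
  show "parcs G \<subseteq> pverts G \<times> pverts G"
    using parcs_part in_pverts_G c_in_part parcs_T_sym parcs_T_verts
    by (auto simp: in_parcs_G; blast)
  show "sym (parcs G)"
    using conn_graph.sym_parcs[OF conn_graph_part] parcs_T_sym
    by (intro symI) (auto simp: in_parcs_G dest: symD; blast dest: symD)
  show "irrefl (parcs G)"
  proof (rule irreflI, rule notI)
    fix u assume "(u, u) \<in> parcs G"
    then show False
      using conn_graph.irrefl_parcs[OF conn_graph_part] part_c parcs_T_sym parcs_T_verts(3)
      unfolding in_parcs_G irrefl_def by metis
  qed
  fix u v assume u: "u \<in> pverts G" and v: "v \<in> pverts G"
  have part_subset: "parcs (Gs l) \<subseteq> parcs G" if "l \<in> pverts T" for l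
    using that by (auto simp: in_parcs_G)
  \<comment> \<open>Strengthened to all vertices of part \<open>l\<close>, since the next tree edge
    may leave the part at any of them.\<close>
  have "\<forall>v\<in>pverts (Gs l). (u, v) \<in> (parcs G)\<^sup>*" if "l \<in> pverts T" for l
    using part_in(1)[OF u] that
  proof (induction rule: T.walk_induct)
    case base
    show ?case using part_in[OF u] part_path[OF _ _ _ part_subset] by blast
  next
    case (step x y)
    then have xy: "(x, y) \<in> parcs T" by (simp add: nbrs_def)
    then have "(u, c x y) \<in> (parcs G)\<^sup>*" using step c_in_part by blast
    moreover have "(c x y, c y x) \<in> parcs G" using xy by (auto simp: in_parcs_G)
    ultimately have "(u, c y x) \<in> (parcs G)\<^sup>*" by (rule rtrancl_into_rtrancl)
    moreover have "(c y x, v) \<in> (parcs G)\<^sup>*" if "v \<in> pverts (Gs y)" for v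
      using that part_path[of y, OF _ _ _ part_subset] parcs_T_verts[OF xy]
        c_in_part[OF parcs_T_sym[OF xy]] by blast
    ultimately show ?case by (meson rtrancl_trans)
  qed
  then show "(u, v) \<in> (parcs G)\<^sup>*" using part_in[OF v] by blast
qed

sublocale G: conn_graph G
  by unfold_locales (rule connected_graph_G)

text \<open>The far ends lie in different parts, so they are distinct even where the near ends
  \<open>c i j\<close> coincide; multiplicities of bridge ends are counted through them.\<close>

lemma inj_bridge_end: "inj_on (\<lambda>j. c j i) (nbrs T i)"
  using part_c parcs_T_sym by (intro inj_onI) (metis mem_Collect_eq nbrs_def)

lemma nbrs_G:
  assumes i: "i \<in> pverts T" and u: "u \<in> pverts (Gs i)"
  shows "nbrs G u = nbrs (Gs i) u \<union> (\<lambda>j. c j i) ` {j\<in>nbrs T i. c i j = u}"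
proof -
  have "l = i" if "l \<in> pverts T" "(u, w) \<in> parcs (Gs l)" for l w
    using that i u parcs_part part_unique by metis
  moreover have "l = i" if "(l, j) \<in> parcs T" "u = c l j" for l j
    using that i u part_c part_eq by metis
  ultimately show ?thesis
    using i by (auto simp: nbrs_def in_parcs_G)
qed

text \<open>A constant \<open>F\<close> gives the degrees in the chain, potential differences give
  its Laplacian. Indexing by tree neighbours counts a vertex once for each of its bridges.\<close>

lemma sum_nbrs_G:
  fixes F :: "'a \<Rightarrow> real"
  assumes i: "i \<in> pverts T" and u: "u \<in> pverts (Gs i)"
  shows "(\<Sum>w\<in>nbrs G u. F w) =
    (\<Sum>w\<in>nbrs (Gs i) u. F w) + (\<Sum>j\<in>nbrs T i. if c i j = u then F (c j i) else 0)"
proof -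
  have ne: "c j i \<notin> nbrs (Gs i) u" if "j \<in> nbrs T i" for j
  proof
    assume "c j i \<in> nbrs (Gs i) u"
    then have "c j i \<in> pverts (Gs i)"
      using parcs_part(2)[OF i] by (auto simp: nbrs_def)
    moreover have ij: "(i, j) \<in> parcs T" using that by (simp add: nbrs_def)
    ultimately show False
      using part_eq[OF i] part_c[OF parcs_T_sym[OF ij]] parcs_T_verts(3)[OF ij] by metis
  qed
  have "(\<Sum>w\<in>nbrs G u. F w) = (\<Sum>w\<in>nbrs (Gs i) u. F w)
      + (\<Sum>w\<in>(\<lambda>j. c j i) ` {j\<in>nbrs T i. c i j = u}. F w)"
    unfolding nbrs_G[OF i u]
    using ne T.finite_nbrs conn_graph.finite_nbrs[OF conn_graph_part[OF i]]
    by (intro sum.union_disjoint) auto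
  also have "(\<Sum>w\<in>(\<lambda>j. c j i) ` {j\<in>nbrs T i. c i j = u}. F w)
      = (\<Sum>j\<in>{j\<in>nbrs T i. c i j = u}. F (c j i))"
    using inj_bridge_end by (subst sum.reindex) (auto intro: inj_on_subset)
  also have "\<dots> = (\<Sum>j\<in>nbrs T i. if c i j = u then F (c j i) else 0)"
    using T.finite_nbrs by (simp add: sum.inter_filter)
  finally show ?thesis .
qed

lemma deg_G:
  assumes "i \<in> pverts T" and "u \<in> pverts (Gs i)"
  shows "deg G u = deg (Gs i) u + (\<Sum>j\<in>nbrs T i. if c i j = u then 1 else 0)"
  using sum_nbrs_G[OF assms, of "\<lambda>_. 1"] by (simp add: deg_def)

section \<open>The two sides of a bridge and their degree mass\<close>

definition block :: "nat \<Rightarrow> nat \<Rightarrow> 'a set" where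
  "block i j = {u \<in> pverts G. part u \<in> side T i j}"

definition block_ind :: "nat \<Rightarrow> nat \<Rightarrow> 'a \<Rightarrow> real" where
  "block_ind i j u = (if part u \<in> side T i j then 1 else 0)"

definition vol :: "nat \<Rightarrow> nat \<Rightarrow> real" where
  "vol i j = (\<Sum>u\<in>block i j. deg G u)"

lemma finite_block: "finite (block i j)"
  using G.finite_verts by (simp add: block_def)

lemma vol_eq: "vol i j = (\<Sum>u\<in>pverts G. deg G u * block_ind i j u)"
  using G.finite_verts unfolding vol_def block_def block_ind_def
  by (intro sum.mono_neutral_cong_left) auto

lemma block_ind_swap:
  "(i, j) \<in> parcs T \<Longrightarrow> u \<in> pverts G \<Longrightarrow> block_ind j i u = 1 - block_ind i j u"
  using T.side_iff part_in(1) by (auto simp: block_ind_def)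

lemma vol_add:
  assumes "(i, j) \<in> parcs T"
  shows "vol i j + vol j i = 2 * real (num_edges G)"
proof -
  have "vol i j + vol j i = (\<Sum>u\<in>pverts G. deg G u)"
    unfolding vol_eq sum.distrib[symmetric] distrib_left[symmetric]
    by (intro sum.cong) (auto simp: block_ind_swap[OF assms])
  then show ?thesis using G.sum_deg by simp
qed

lemma bridge_notin_part:
  assumes "(i, j) \<in> parcs T" and "l \<in> pverts T"
  shows "(c i j, c j i) \<notin> parcs (Gs l)"
proof
  assume "(c i j, c j i) \<in> parcs (Gs l)"
  then have "part (c i j) = part (c j i)"
    using parcs_part[OF assms(2)] part_eq[OF assms(2)] by metis
  then show False
    using assms(1) part_c parcs_T_sym parcs_T_verts(3) by metis
qed

lemma block_closed:
  assumes ij: "(i, j) \<in> parcs T" and uw: "(u, w) \<in> parcs G"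
    and ne: "(u, w) \<noteq> (c i j, c j i)" "(u, w) \<noteq> (c j i, c i j)"
  shows "u \<in> block i j \<longleftrightarrow> w \<in> block i j"
proof -
  have V: "u \<in> pverts G" "w \<in> pverts G" using uw G.parcs_subset by auto
  from uw consider l where "l \<in> pverts T" "(u, w) \<in> parcs (Gs l)"
    | a b where "(a, b) \<in> parcs T" "u = c a b" "w = c b a"
    unfolding in_parcs_G by blast
  then show ?thesis
  proof cases
    case 1
    then have "part u = part w" using parcs_part part_eq by metis
    then show ?thesis using V by (simp add: block_def)
  next
    case 2
    then have "(a, b) \<noteq> (i, j)" "(a, b) \<noteq> (j, i)" using ne by auto
    moreover have "part u = a" "part w = b" using 2 part_c parcs_T_sym by auto
    ultimately show ?thesis using V T.side_closed[OF 2(1)] by (simp add: block_def)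
  qed
qed

lemma c_in_block:
  assumes "(i, j) \<in> parcs T"
  shows "c i j \<in> block i j" and "c j i \<notin> block i j"
proof -
  have ji: "(j, i) \<in> parcs T" using assms by (rule parcs_T_sym)
  show "c i j \<in> block i j"
    using assms c_in_part[OF assms] parcs_T_verts[OF assms] in_pverts_G
    by (auto simp: block_def part_c side_self)
  have "j \<notin> side T i j"
    using T.side_disjoint[OF assms] side_self[of j T i] by blast
  then show "c j i \<notin> block i j"
    using ji by (auto simp: block_def part_c)
qed

text \<open>Identifies the component behind \<open>W\<close> with a set read off the tree: no
  remaining arc leaves the block, and a tree path avoiding the cut edge lifts to a path in the
  chain.\<close>

lemma reachable_del_bridge:
  assumes ij: "(i, j) \<in> parcs T"
  shows "reachable (with_proj (del_edge G (c i j) (c j i))) (c i j) v \<longleftrightarrow> v \<in> block i j"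
proof -
  let ?x = "c i j" and ?y = "c j i"
  let ?D = "del_edge G ?x ?y"
  have ji: "(j, i) \<in> parcs T" using ij by (rule parcs_T_sym)
  interpret D: pair_wf_digraph ?D
    using G.parcs_subset by unfold_locales (auto simp: del_edge_def)
  have "reachable (with_proj ?D) ?x v \<longleftrightarrow> (?x, v) \<in> (parcs ?D)\<^sup>*"
    using c_in_block(1)[OF ij] by (subst D.reachable_conv') (auto simp: del_edge_def block_def)
  also have "\<dots> \<longleftrightarrow> v \<in> block i j"
  proof
    assume "(?x, v) \<in> (parcs ?D)\<^sup>*"
    then show "v \<in> block i j"
    proof (induction rule: rtrancl_induct)
      case base
      show ?case by (rule c_in_block(1)[OF ij])
    next
      case (step u w)
      then show ?case using block_closed[OF ij, of u w] by (auto simp: del_edge_def)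
    qed
  next
    have part_D: "parcs (Gs l) \<subseteq> parcs ?D" if "l \<in> pverts T" for l
      using that bridge_notin_part[OF ij that] bridge_notin_part[OF ji that]
      by (auto simp: del_edge_def in_parcs_G)
    assume v: "v \<in> block i j"
    then have "(i, part v) \<in> (parcs T - {(i, j), (j, i)})\<^sup>*"
      by (simp add: block_def side_def)
    then have "\<forall>w\<in>pverts (Gs (part v)). (?x, w) \<in> (parcs ?D)\<^sup>*"
    proof (induction rule: rtrancl_induct)
      case base
      show ?case
        using part_path[of i ?x] c_in_part[OF ij] part_D parcs_T_verts[OF ij] by blast
    next
      case (step a b)
      then have ab: "(a, b) \<in> parcs T" "(a, b) \<noteq> (i, j)" "(a, b) \<noteq> (j, i)" by auto
      have "(c a b, c b a) \<in> parcs ?D"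
        using ab bridge_arc_eq[OF ij ab(1)] bridge_arc_eq[OF ji ab(1)]
        by (auto simp: del_edge_def in_parcs_G)
      moreover have "(?x, c a b) \<in> (parcs ?D)\<^sup>*"
        using step c_in_part[OF ab(1)] by blast
      ultimately have "(?x, c b a) \<in> (parcs ?D)\<^sup>*" by (meson rtrancl_into_rtrancl)
      moreover have "(c b a, w) \<in> (parcs ?D)\<^sup>*" if "w \<in> pverts (Gs b)" for w
        using that part_path[of b "c b a" w] c_in_part[OF parcs_T_sym[OF ab(1)]] part_D
          parcs_T_verts[OF ab(1)] by blast
      ultimately show ?case by (meson rtrancl_trans)
    qed
    then show "(?x, v) \<in> (parcs ?D)\<^sup>*"
      using v part_in by (auto simp: block_def)
  qed
  finally show ?thesis .
qed

text \<open>The arcs starting in the block are those of the component, two per edge, and the one arc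
  that leaves across the bridge.\<close>

lemma vol_eq_W:
  assumes ij: "(i, j) \<in> parcs T"
  shows "vol i j = 2 * real (W G (c i j) (c j i)) + 1"
proof -
  let ?x = "c i j" and ?y = "c j i"
  let ?C = "component_of (del_edge G ?x ?y) ?x"
  have parcs_C: "parcs ?C = {(u, w) \<in> parcs G. u \<in> block i j \<and> w \<in> block i j}"
  proof -
    have "parcs ?C = {(u, w) \<in> parcs (del_edge G ?x ?y). u \<in> block i j \<and> w \<in> block i j}"
      by (simp add: component_of_def reachable_del_bridge[OF ij])
    then show ?thesis using c_in_block[OF ij] by (auto simp: del_edge_def)
  qed
  have fin: "finite (parcs ?C)"
    using G.finite_parcs unfolding parcs_C by (rule rev_finite_subset) auto
  have "even (card (parcs ?C))"
    using G.sym_parcs G.irrefl_parcs fin unfolding parcs_C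
    by (intro even_card_sym_irrefl) (auto simp: sym_def irrefl_def)
  then have card_C: "card (parcs ?C) = 2 * W G ?x ?y"
    by (simp add: W_def num_edges_def)
  have xy: "(?x, ?y) \<in> parcs G" using ij by (auto simp: in_parcs_G)
  have "(SIGMA u:block i j. nbrs G u) = insert (?x, ?y) (parcs ?C)"
    using block_closed[OF ij] c_in_block[OF ij] xy unfolding parcs_C
    by (auto simp: nbrs_def)
  then have "card (SIGMA u:block i j. nbrs G u) = card (parcs ?C) + 1"
    using fin c_in_block[OF ij] by (simp add: parcs_C)
  then have "(\<Sum>u\<in>block i j. card (nbrs G u)) = 2 * W G ?x ?y + 1"
    using finite_block G.finite_nbrs card_C by (simp add: card_SigmaI)
  then have "real (\<Sum>u\<in>block i j. card (nbrs G u)) = real (2 * W G ?x ?y + 1)"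
    by (simp only:)
  then show ?thesis by (simp add: vol_def deg_def)
qed

text \<open>Complement within the total degree 2m. The mass \<open>vol j i + 1\<close> appearing
  below is thus twice \<open>Wbar\<close> at the end \<open>c i j\<close>.\<close>

lemma vol_eq_Wbar:
  assumes "(i, j) \<in> parcs T"
  shows "vol j i = 2 * Wbar G (c i j) (c j i) - 1"
  using vol_add[OF assms] vol_eq_W[OF assms] by (simp add: Wbar_def)

subsection \<open>Resistances in a chain\<close>

text \<open>The vertex of part \<open>i\<close> at which every path from \<open>u\<close> enters that part.\<close>

definition proj :: "nat \<Rightarrow> 'a \<Rightarrow> 'a" where
  "proj i u = (if part u = i then u else c i (THE j. j \<in> nbrs T i \<and> part u \<in> side T j i))"

lemma proj_self: "i \<in> pverts T \<Longrightarrow> u \<in> pverts (Gs i) \<Longrightarrow> proj i u = u"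
  by (simp add: proj_def part_eq)

lemma side_notin: "j \<in> nbrs T i \<Longrightarrow> i \<notin> side T j i"
  using T.side_disjoint[of i j] side_self[of i T j] by (auto simp: nbrs_def)

lemma proj_branch:
  assumes "j \<in> nbrs T i" and "u \<in> block j i"
  shows "proj i u = c i j"
proof -
  have i: "i \<in> pverts T" using assms(1) parcs_T_verts by (auto simp: nbrs_def)
  have u: "part u \<in> pverts T" "part u \<in> side T j i"
    using assms(2) part_in by (auto simp: block_def)
  then have "part u \<noteq> i" using side_notin[OF assms(1)] by auto
  moreover have "(THE j. j \<in> nbrs T i \<and> part u \<in> side T j i) = j"
    using T.ex1_branch[OF i u(1) \<open>part u \<noteq> i\<close>] assms(1) u(2) by (intro the1_equality) auto
  ultimately show ?thesis by (simp add: proj_def)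
qed

lemma branch_exists:
  assumes "i \<in> pverts T" and "u \<in> pverts G" and "part u \<noteq> i"
  obtains j where "j \<in> nbrs T i" and "u \<in> block j i"
  using T.ex1_branch[OF assms(1) part_in(1)[OF assms(2)] assms(3)] assms(2)
  by (auto simp: block_def)

lemma proj_in:
  assumes "i \<in> pverts T" and "u \<in> pverts G"
  shows "proj i u \<in> pverts (Gs i)"
proof (cases "part u = i")
  case True
  then show ?thesis using part_in[OF assms(2)] by (simp add: proj_def)
next
  case False
  then obtain j where "j \<in> nbrs T i" "u \<in> block j i"
    using branch_exists assms by blast
  then show ?thesis using proj_branch c_in_part by (simp add: nbrs_def)
qed

lemma proj_part_cong: "part u = part w \<Longrightarrow> part u \<noteq> i \<Longrightarrow> proj i u = proj i w"
  by (simp add: proj_def)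

text \<open>In the bridge's own parts the far end projects to the near end; from any other part both
  ends are seen in the same branch. Hence lifted part potentials drive no current through
  bridges.\<close>

lemma proj_bridge:
  assumes ij: "(i, j) \<in> parcs T"
  shows "proj l (c i j) = proj l (c j i)"
proof -
  have ji: "(j, i) \<in> parcs T" using ij by (rule parcs_T_sym)
  have c: "c i j \<in> pverts (Gs i)" "c j i \<in> pverts (Gs j)"
    using c_in_part ij ji by auto
  note V = parcs_T_verts[OF ij]
  have J: "j \<in> nbrs T i" "i \<in> nbrs T j" using ij ji by (auto simp: nbrs_def)
  consider "l = i" | "l = j" | "l \<noteq> i" "l \<noteq> j" by blast
  then show ?thesis
  proof cases
    case 1
    then show ?thesis
      using proj_branch[OF J(1) c_in_block(1)[OF ji]] proj_self[OF V(1) c(1)] by simp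
  next
    case 2
    then show ?thesis
      using proj_branch[OF J(2) c_in_block(1)[OF ij]] proj_self[OF V(2) c(2)] by simp
  next
    case 3
    have "(\<lambda>m. m \<in> nbrs T l \<and> i \<in> side T m l) = (\<lambda>m. m \<in> nbrs T l \<and> j \<in> side T m l)"
      using T.side_closed[OF ij] 3 by (intro ext) auto
    then show ?thesis using 3 by (simp add: proj_def part_c[OF ij] part_c[OF ji])
  qed
qed

text \<open>Along a bridge the only side indicators that jump are the two belonging to that
  bridge.\<close>

lemma block_ind_bridge:
  assumes ij: "(i, j) \<in> parcs T" and ab: "(a, b) \<in> parcs T"
  shows "block_ind a b (c i j) - block_ind a b (c j i) =
    (if (a, b) = (i, j) then 1 else 0) - (if (a, b) = (j, i) then 1 else 0)"
proof -
  have *: "a \<in> side T a b" "b \<notin> side T a b" "a \<noteq> b"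
    using side_self[of a T b] side_notin[where i=b and j=a] parcs_T_sym[OF ab] parcs_T_verts(3)[OF ab]
    by (auto simp: nbrs_def)
  show ?thesis
    using * T.side_closed[OF ij, of a b]
    by (auto simp: block_ind_def part_c[OF ij] part_c[OF parcs_T_sym[OF ij]])
qed

text \<open>Each bridge occurs as two opposite arcs. With d the current along one of them and b the
  indicator of its side, the two terms are d b and (-d) (1 - b), so half their sum is d b up to a
  constant.\<close>

definition chain_potential :: "'a \<Rightarrow> 'a \<Rightarrow> 'a \<Rightarrow> real" where
  "chain_potential u v w =
     (\<Sum>i\<in>pverts T. conn_graph.potential (Gs i) (proj i u) (proj i v) (proj i w))
   + (\<Sum>(i, j)\<in>parcs T. (block_ind i j u - block_ind i j v) * block_ind i j w) / 2"

text \<open>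
  A unit current from \<open>u\<close> to \<open>v\<close> sends \<open>block_ind i j u - block_ind i j v\<close> across the bridge
  \<open>c i j \<sim> c j i\<close>; the next lemma is the contribution of \<open>u\<close> to its conservation at \<open>w\<close>.
\<close>

lemma current_balance:
  assumes i: "i \<in> pverts T" and w: "w \<in> pverts (Gs i)" and u: "u \<in> pverts G"
  shows "(if w = proj i u then 1 else 0) + (\<Sum>j\<in>nbrs T i. if c i j = w then block_ind i j u else 0)
    = (if w = u then 1 else 0) + (\<Sum>j\<in>nbrs T i. if c i j = w then 1 else (0::real))"
proof (cases "part u = i")
  case True
  then show ?thesis
    by (auto simp: proj_def block_ind_def side_self intro!: sum.cong)
next
  case False
  then obtain m where m: "m \<in> nbrs T i" "u \<in> block m i"
    using branch_exists i u by blast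
  \<comment> \<open>Cutting the edge to any neighbour but \<open>m\<close> leaves \<open>u\<close>
    on the side of \<open>i\<close>; the 1 missing at \<open>j = m\<close> is supplied by the gate
    \<open>proj i u = c i m\<close>.\<close>
  have ind: "block_ind i j u = 1 - (if j = m then 1 else 0)" if "j \<in> nbrs T i" for j
  proof -
    have ij: "(i, j) \<in> parcs T" using that by (simp add: nbrs_def)
    have "block_ind j i u = (if j = m then 1 else 0)"
      using T.ex1_branch[OF i part_in(1)[OF u] False] that m
      by (auto simp: block_ind_def block_def)
    then show ?thesis using block_ind_swap[OF parcs_T_sym[OF ij] u] by simp
  qed
  have "w \<noteq> u" using False part_eq[OF i w] by auto
  have "(\<Sum>j\<in>nbrs T i. if c i j = w then block_ind i j u else 0)
      = (\<Sum>j\<in>nbrs T i. (if c i j = w then 1 else 0) - (if j = m then (if c i m = w then 1 else 0) else 0))"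
    using ind by (intro sum.cong) auto
  also have "\<dots> = (\<Sum>j\<in>nbrs T i. if c i j = w then 1 else 0) - (if c i m = w then 1 else 0)"
    using m(1) T.finite_nbrs by (simp add: sum_subtractf)
  finally show ?thesis
    using \<open>w \<noteq> u\<close> proj_branch[OF m] by auto
qed

lemma chain_potential_bridge:
  assumes ij: "(i, j) \<in> parcs T" and u: "u \<in> pverts G" and v: "v \<in> pverts G"
  shows "chain_potential u v (c i j) - chain_potential u v (c j i) = block_ind i j u - block_ind i j v"
proof -
  let ?d = "\<lambda>(a, b). block_ind a b u - block_ind a b v"
  have ji: "(j, i) \<in> parcs T" using ij by (rule parcs_T_sym)
  have distr: "d * ((if P then 1 else 0) - (if Q then 1 else 0)) = (if P then d else 0) - (if Q then d else 0)"
    for P Q and d :: real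
    by simp
  have "chain_potential u v (c i j) - chain_potential u v (c j i) =
      (\<Sum>(a, b)\<in>parcs T. ?d (a, b) * (block_ind a b (c i j) - block_ind a b (c j i))) / 2"
  proof -
    have "(\<Sum>(a, b)\<in>parcs T. ?d (a, b) * block_ind a b (c i j)) -
        (\<Sum>(a, b)\<in>parcs T. ?d (a, b) * block_ind a b (c j i)) =
        (\<Sum>(a, b)\<in>parcs T. ?d (a, b) * (block_ind a b (c i j) - block_ind a b (c j i)))"
      unfolding sum_subtractf[symmetric] by (intro sum.cong refl) (auto simp: right_diff_distrib)
    then show ?thesis
      by (simp add: chain_potential_def proj_bridge[OF ij] diff_divide_distrib)
  qed
  also have "(\<Sum>(a, b)\<in>parcs T. ?d (a, b) * (block_ind a b (c i j) - block_ind a b (c j i)))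
      = (\<Sum>e\<in>parcs T. (if e = (i, j) then ?d e else 0) - (if e = (j, i) then ?d e else 0))"
  proof (intro sum.cong refl)
    fix e assume e: "e \<in> parcs T"
    obtain a b where ab: "e = (a, b)" by (cases e)
    show "(case e of (a, b) \<Rightarrow> ?d (a, b) * (block_ind a b (c i j) - block_ind a b (c j i)))
        = (if e = (i, j) then ?d e else 0) - (if e = (j, i) then ?d e else 0)"
      unfolding ab prod.case block_ind_bridge[OF ij e[unfolded ab]]
      by (rule distr)
  qed
  also have "\<dots> = ?d (i, j) - ?d (j, i)"
    unfolding sum_subtractf sum.delta[OF T.finite_parcs] using ij ji by (simp only: if_True)
  \<comment> \<open>The currents along opposite arcs are negatives of each other, so the half
    disappears.\<close>
  also have "\<dots> / 2 = block_ind i j u - block_ind i j v"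
    using block_ind_swap[OF ij] u v by simp
  finally show ?thesis .
qed

lemma laplacian_chain_potential:
  assumes u: "u \<in> pverts G" and v: "v \<in> pverts G" and w: "w \<in> pverts G"
  shows "laplacian G (chain_potential u v) w =
    (if w = u then 1 else 0) - (if w = v then 1 else 0)"
proof -
  define i where "i = part w"
  have i: "i \<in> pverts T" and wi: "w \<in> pverts (Gs i)"
    using part_in[OF w] by (simp_all add: i_def)
  interpret Gi: conn_graph "Gs i" using conn_graph_part[OF i] .
  let ?P = "\<lambda>l. conn_graph.potential (Gs l) (proj l u) (proj l v)"
  \<comment> \<open>Inside part \<open>i\<close> the side indicators and the gates into all other
    parts are constant, so only the potential of this part varies.\<close>
  have inside: "chain_potential u v w - chain_potential u v x = ?P i w - ?P i x"
    if "x \<in> nbrs (Gs i) w" for x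
  proof -
    have x: "x \<in> pverts (Gs i)" using that Gi.nbrs_subset by blast
    then have px: "part x = part w" using part_eq i by (simp add: i_def)
    have "chain_potential u v w - chain_potential u v x
        = (\<Sum>l\<in>pverts T. ?P l (proj l w) - ?P l (proj l x))"
      by (simp add: chain_potential_def sum_subtractf block_ind_def px)
    also have "\<dots> = (\<Sum>l\<in>pverts T. if l = i then ?P i w - ?P i x else 0)"
      using proj_part_cong[OF px[symmetric]] proj_self[OF i wi] proj_self[OF i x]
      by (intro sum.cong) (auto simp: i_def)
    finally show ?thesis using i T.finite_verts by simp
  qed
  have "laplacian G (chain_potential u v) w =
      (\<Sum>x\<in>nbrs (Gs i) w. chain_potential u v w - chain_potential u v x)
    + (\<Sum>j\<in>nbrs T i. if c i j = w then chain_potential u v w - chain_potential u v (c j i) else 0)"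
    unfolding laplacian_def by (rule sum_nbrs_G[OF i wi])
  also have "(\<Sum>x\<in>nbrs (Gs i) w. chain_potential u v w - chain_potential u v x) = laplacian (Gs i) (?P i) w"
    unfolding laplacian_def using inside by (intro sum.cong) auto
  also have "\<dots> = (if w = proj i u then 1 else 0) - (if w = proj i v then 1 else 0)"
    using i u v wi proj_in by (intro Gi.laplacian_potential) auto
  also have "(\<Sum>j\<in>nbrs T i. if c i j = w then chain_potential u v w - chain_potential u v (c j i) else 0)
      = (\<Sum>j\<in>nbrs T i. if c i j = w then block_ind i j u else 0)
      - (\<Sum>j\<in>nbrs T i. if c i j = w then block_ind i j v else 0)"
    unfolding sum_subtractf[symmetric]
    using chain_potential_bridge[OF _ u v] by (intro sum.cong) (auto simp: nbrs_def)
  finally show ?thesis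
    using current_balance[OF i wi u] current_balance[OF i wi v] by linarith
qed

text \<open>The step function of a bridge with current d drops by d times d between \<open>u\<close>
  and \<open>v\<close>, which is 1 if the bridge separates them and 0 otherwise; the half again
  accounts for the two arcs.\<close>

lemma resistance_chain:
  assumes u: "u \<in> pverts G" and v: "v \<in> pverts G"
  shows "resistance G u v = (\<Sum>i\<in>pverts T. resistance (Gs i) (proj i u) (proj i v))
    + (\<Sum>(i, j)\<in>parcs T. (block_ind i j u - block_ind i j v)\<^sup>2) / 2"
proof -
  have "resistance G u v = chain_potential u v u - chain_potential u v v"
    using u v laplacian_chain_potential by (intro G.resistance_eq_potential_diff) auto
  also have "\<dots> = (\<Sum>i\<in>pverts T. conn_graph.potential (Gs i) (proj i u) (proj i v) (proj i u)
        - conn_graph.potential (Gs i) (proj i u) (proj i v) (proj i v))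
    + (\<Sum>(i, j)\<in>parcs T. (block_ind i j u - block_ind i j v)\<^sup>2) / 2"
  proof -
    have "(\<Sum>(i, j)\<in>parcs T. (block_ind i j u - block_ind i j v) * block_ind i j u) -
        (\<Sum>(i, j)\<in>parcs T. (block_ind i j u - block_ind i j v) * block_ind i j v) =
        (\<Sum>(i, j)\<in>parcs T. (block_ind i j u - block_ind i j v)\<^sup>2)"
      unfolding sum_subtractf[symmetric]
      by (intro sum.cong refl) (auto simp: power2_eq_square right_diff_distrib)
    then show ?thesis
      by (simp add: chain_potential_def sum_subtractf diff_divide_distrib)
  qed
  also have "(\<Sum>i\<in>pverts T. conn_graph.potential (Gs i) (proj i u) (proj i v) (proj i u)
        - conn_graph.potential (Gs i) (proj i u) (proj i v) (proj i v))
      = (\<Sum>i\<in>pverts T. resistance (Gs i) (proj i u) (proj i v))"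
    using conn_graph.potential_diff[OF conn_graph_part] by (intro sum.cong) auto
  finally show ?thesis .
qed

section \<open>Degree-weighted sums of resistances\<close>

text \<open>The gate map collapses a whole branch, of mass \<open>vol j i\<close>, to
  \<open>c i j\<close>; the extra 1 is what the bridge adds to the degree of \<open>c i j\<close>
  itself.\<close>

lemma sum_deg_proj:
  assumes i: "i \<in> pverts T"
  shows "(\<Sum>u\<in>pverts G. deg G u * F (proj i u)) =
    (\<Sum>a\<in>pverts (Gs i). deg (Gs i) a * F a) + (\<Sum>j\<in>nbrs T i. (vol j i + 1) * F (c i j))"
proof -
  interpret Gi: conn_graph "Gs i" using conn_graph_part[OF i] .
  let ?f = "\<lambda>u. deg G u * F (proj i u)"
  have split: "pverts G = pverts (Gs i) \<union> (\<Union>j\<in>nbrs T i. block j i)"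
  proof (intro equalityI subsetI)
    fix u assume u: "u \<in> pverts G"
    show "u \<in> pverts (Gs i) \<union> (\<Union>j\<in>nbrs T i. block j i)"
    proof (cases "part u = i")
      case True
      then show ?thesis using part_in(2)[OF u] by simp
    next
      case False
      then show ?thesis using branch_exists[OF i u] by blast
    qed
  next
    fix u assume "u \<in> pverts (Gs i) \<union> (\<Union>j\<in>nbrs T i. block j i)"
    then show "u \<in> pverts G" using in_pverts_G[OF i] by (auto simp: block_def)
  qed
  have notin: "u \<notin> block j i" if "u \<in> pverts (Gs i)" "j \<in> nbrs T i" for u j
    using that part_eq[OF i] side_notin by (auto simp: block_def)
  have disj: "block j i \<inter> block j' i = {}" if "j \<in> nbrs T i" "j' \<in> nbrs T i" "j \<noteq> j'" for j j'
  proof (rule ccontr)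
    assume "block j i \<inter> block j' i \<noteq> {}"
    then obtain u where u: "u \<in> pverts G" "part u \<in> side T j i" "part u \<in> side T j' i"
      by (auto simp: block_def)
    then have "part u \<noteq> i" using side_notin that by metis
    then show False
      using T.ex1_branch[OF i part_in(1)[OF u(1)]] u that by blast
  qed
  have "(\<Sum>u\<in>pverts G. ?f u) = (\<Sum>u\<in>pverts (Gs i). ?f u) + (\<Sum>u\<in>(\<Union>j\<in>nbrs T i. block j i). ?f u)"
    unfolding split using Gi.finite_verts T.finite_nbrs finite_block notin
    by (intro sum.union_disjoint) auto
  also have "(\<Sum>u\<in>(\<Union>j\<in>nbrs T i. block j i). ?f u) = (\<Sum>j\<in>nbrs T i. \<Sum>u\<in>block j i. ?f u)"
    using T.finite_nbrs finite_block disj by (intro sum.UNION_disjoint) auto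
  also have "\<dots> = (\<Sum>j\<in>nbrs T i. vol j i * F (c i j))"
    by (intro sum.cong refl) (simp add: vol_def sum_distrib_right proj_branch)
  also have "(\<Sum>u\<in>pverts (Gs i). ?f u) = (\<Sum>a\<in>pverts (Gs i). deg (Gs i) a * F a)
      + (\<Sum>a\<in>pverts (Gs i). \<Sum>j\<in>nbrs T i. if c i j = a then F a else 0)"
    unfolding sum.distrib[symmetric]
    by (intro sum.cong refl)
       (auto simp: proj_self[OF i] deg_G[OF i] distrib_right sum_distrib_right intro!: sum.cong)
  also have "(\<Sum>a\<in>pverts (Gs i). \<Sum>j\<in>nbrs T i. if c i j = a then F a else 0)
      = (\<Sum>j\<in>nbrs T i. F (c i j))"
    using Gi.finite_verts c_in_part by (subst sum.swap) (auto simp: nbrs_def intro!: sum.cong)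
  finally show ?thesis by (simp add: distrib_right sum.distrib)
qed

lemma sum_block_ind_diff:
  assumes ij: "(i, j) \<in> parcs T"
  shows "(\<Sum>u\<in>pverts G. \<Sum>v\<in>pverts G. deg G u * deg G v * (block_ind i j u - block_ind i j v)\<^sup>2)
    = 2 * vol i j * vol j i"
proof -
  \<comment> \<open>For a and b in {0, 1}, the square of a - b is a (1 - b) + (1 - a) b: the two
    orders in which a pair can be separated.\<close>
  have "(\<Sum>u\<in>pverts G. \<Sum>v\<in>pverts G. deg G u * deg G v * (block_ind i j u - block_ind i j v)\<^sup>2)
     = (\<Sum>u\<in>pverts G. \<Sum>v\<in>pverts G.
          (deg G u * block_ind i j u) * (deg G v * block_ind j i v)
        + (deg G u * block_ind j i u) * (deg G v * block_ind i j v))"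
    using block_ind_swap[OF ij] by (intro sum.cong refl) (auto simp: block_ind_def)
  also have "\<dots> = vol i j * vol j i + vol j i * vol i j"
    unfolding vol_eq sum_product sum.distrib ..
  finally show ?thesis by simp
qed

lemma sum_deg_deg_resistance_proj:
  assumes i: "i \<in> pverts T"
  shows "(\<Sum>u\<in>pverts G. \<Sum>v\<in>pverts G. deg G u * deg G v * resistance (Gs i) (proj i u) (proj i v))
    = 4 * real (num_edges G) * kemeny (Gs i)
    + 2 * (\<Sum>j\<in>nbrs T i. (vol j i + 1) * accessibility_index (Gs i) (c i j))
    + (\<Sum>j\<in>nbrs T i. \<Sum>j'\<in>nbrs T i.
        (vol j i + 1) * (vol j' i + 1) * resistance (Gs i) (c i j) (c i j'))"
proof -
  interpret Gi: conn_graph "Gs i" using conn_graph_part[OF i] .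
  let ?R = "resistance (Gs i)" and ?d = "deg (Gs i)" 
  let ?A = "accessibility_index (Gs i)" and ?K = "kemeny (Gs i)"
  define w where "w j = vol j i + 1" for j
  note proj_sum = sum_deg_proj[OF i, folded w_def]
  have c: "c i j \<in> pverts (Gs i)" if "j \<in> nbrs T i" for j
    using that c_in_part by (simp add: nbrs_def)
  \<comment> \<open>With one argument held fixed, so that the two variables are pushed forward one
    after the other by \<open>proj_sum\<close>.\<close>
  define S where "S a = (\<Sum>v\<in>pverts G. deg G v * ?R a (proj i v))" for a
  have S: "S a = ?A a + ?K + (\<Sum>j\<in>nbrs T i. w j * ?R a (c i j))" if "a \<in> pverts (Gs i)" for a
    unfolding S_def proj_sum using Gi.sum_deg_resistance[OF that]
    by (simp add: resistance_sym)
  have "(\<Sum>u\<in>pverts G. \<Sum>v\<in>pverts G. deg G u * deg G v * ?R (proj i u) (proj i v))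
      = (\<Sum>u\<in>pverts G. deg G u * S (proj i u))"
    by (simp add: S_def sum_distrib_left mult.assoc)
  also have "\<dots> = (\<Sum>a\<in>pverts (Gs i). ?d a * S a) + (\<Sum>j\<in>nbrs T i. w j * S (c i j))"
    by (rule proj_sum)
  also have "(\<Sum>a\<in>pverts (Gs i). ?d a * S a)
      = (\<Sum>a\<in>pverts (Gs i). \<Sum>b\<in>pverts (Gs i). ?d a * ?d b * ?R a b)
      + (\<Sum>a\<in>pverts (Gs i). \<Sum>j\<in>nbrs T i. w j * (?d a * ?R a (c i j)))"
    unfolding S_def proj_sum
    by (simp add: sum.distrib distrib_left sum_distrib_left mult_ac)
  also have "(\<Sum>a\<in>pverts (Gs i). \<Sum>j\<in>nbrs T i. w j * (?d a * ?R a (c i j)))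
      = (\<Sum>j\<in>nbrs T i. w j * (?A (c i j) + ?K))"
    by (subst sum.swap) (simp add: sum_distrib_left[symmetric] Gi.sum_deg_resistance c)
  also have "(\<Sum>j\<in>nbrs T i. w j * S (c i j)) = (\<Sum>j\<in>nbrs T i. w j * (?A (c i j) + ?K))
      + (\<Sum>j\<in>nbrs T i. \<Sum>j'\<in>nbrs T i. w j * w j' * ?R (c i j) (c i j'))"
    unfolding sum.distrib[symmetric]
    by (intro sum.cong refl) (simp only: S c distrib_left sum_distrib_left mult.assoc)
  also have "(\<Sum>a\<in>pverts (Gs i). \<Sum>b\<in>pverts (Gs i). ?d a * ?d b * ?R a b)
      = 4 * real (num_edges (Gs i)) * ?K"
    by (rule Gi.sum_deg_deg_resistance)
  also have "(\<Sum>j\<in>nbrs T i. w j * (?A (c i j) + ?K))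
      = (\<Sum>j\<in>nbrs T i. w j * ?A (c i j)) + (\<Sum>j\<in>nbrs T i. w j) * ?K"
    by (simp only: distrib_left sum.distrib sum_distrib_right)
  \<comment> \<open>\<open>F = 1\<close> compares total masses. The coefficient of \<open>?K\<close>
    becomes 4 m_i + 2 (2 m_G - 2 m_i) = 4 m_G, so that Kemeny's constants of the parts enter the
    final formula with coefficient 1.\<close>
  also have "(\<Sum>j\<in>nbrs T i. w j) = 2 * real (num_edges G) - 2 * real (num_edges (Gs i))"
    using proj_sum[of "\<lambda>_. 1"] G.sum_deg Gi.sum_deg by simp
  finally show ?thesis unfolding w_def[symmetric] by (simp add: algebra_simps)
qed

lemma kemeny_chain:
  assumes "num_edges G \<ge> 1"
  shows "kemeny G = (\<Sum>i\<in>pverts T. kemeny (Gs i)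
      + (\<Sum>j\<in>nbrs T i. (vol j i + 1) * accessibility_index (Gs i) (c i j)) / (2 * real (num_edges G))
      + (\<Sum>j\<in>nbrs T i. \<Sum>j'\<in>nbrs T i.
          (vol j i + 1) * (vol j' i + 1) * resistance (Gs i) (c i j) (c i j')) / (4 * real (num_edges G)))
    + (\<Sum>(i, j)\<in>parcs T. vol i j * vol j i) / (4 * real (num_edges G))"
proof -
  let ?m = "real (num_edges G)"
  have m: "?m > 0" using assms by simp
  have divide_cancel: "a = b / k" if "k * a = b" and "k \<noteq> 0" for a b k :: real
    using that by (simp add: field_simps)
  have divide_sum: "(4 * ?m * a + 2 * x + y) / (4 * ?m) = a + x / (2 * ?m) + y / (4 * ?m)" for a x y
    using m by (simp add: field_simps)
  have "4 * ?m * kemeny G = (\<Sum>u\<in>pverts G. \<Sum>v\<in>pverts G. deg G u * deg G v * resistance G u v)"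
    by (rule G.sum_deg_deg_resistance[symmetric])
  also have "\<dots> = (\<Sum>u\<in>pverts G. \<Sum>v\<in>pverts G.
      (\<Sum>i\<in>pverts T. deg G u * deg G v * resistance (Gs i) (proj i u) (proj i v))
    + (\<Sum>(i, j)\<in>parcs T. deg G u * deg G v * (block_ind i j u - block_ind i j v)\<^sup>2) / 2)"
    by (intro sum.cong refl)
       (simp add: resistance_chain distrib_left sum_distrib_left split_def)
  also have "\<dots> =
      (\<Sum>i\<in>pverts T. \<Sum>u\<in>pverts G. \<Sum>v\<in>pverts G. deg G u * deg G v * resistance (Gs i) (proj i u) (proj i v))
    + (\<Sum>(i, j)\<in>parcs T. \<Sum>u\<in>pverts G. \<Sum>v\<in>pverts G. deg G u * deg G v * (block_ind i j u - block_ind i j v)\<^sup>2) / 2"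
    unfolding sum.distrib sum_divide_distrib[symmetric] split_def
      sum_swap3[where I="pverts T"] sum_swap3[where I="parcs T"] ..
  also have "(\<Sum>(i, j)\<in>parcs T. \<Sum>u\<in>pverts G. \<Sum>v\<in>pverts G. deg G u * deg G v * (block_ind i j u - block_ind i j v)\<^sup>2) / 2
      = (\<Sum>(i, j)\<in>parcs T. vol i j * vol j i)"
    unfolding sum_divide_distrib
    by (intro sum.cong refl) (clarsimp simp only: split_beta sum_block_ind_diff fst_conv snd_conv, simp)
  finally have "4 * ?m * kemeny G =
      (\<Sum>i\<in>pverts T. \<Sum>u\<in>pverts G. \<Sum>v\<in>pverts G. deg G u * deg G v * resistance (Gs i) (proj i u) (proj i v))
    + (\<Sum>(i, j)\<in>parcs T. vol i j * vol j i)" .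
  from divide_cancel[OF this] m have "kemeny G =
      (\<Sum>i\<in>pverts T. (\<Sum>u\<in>pverts G. \<Sum>v\<in>pverts G. deg G u * deg G v * resistance (Gs i) (proj i u) (proj i v)) / (4 * ?m))
    + (\<Sum>(i, j)\<in>parcs T. vol i j * vol j i) / (4 * ?m)"
    by (simp only: sum_divide_distrib[symmetric] add_divide_distrib[symmetric])
  also have "(\<Sum>i\<in>pverts T. (\<Sum>u\<in>pverts G. \<Sum>v\<in>pverts G. deg G u * deg G v * resistance (Gs i) (proj i u) (proj i v)) / (4 * ?m))
    = (\<Sum>i\<in>pverts T. kemeny (Gs i)
      + (\<Sum>j\<in>nbrs T i. (vol j i + 1) * accessibility_index (Gs i) (c i j)) / (2 * ?m)
      + (\<Sum>j\<in>nbrs T i. \<Sum>j'\<in>nbrs T i.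
          (vol j i + 1) * (vol j' i + 1) * resistance (Gs i) (c i j) (c i j')) / (4 * ?m))"
    using m by (intro sum.cong refl) (simp only: sum_deg_deg_resistance_proj divide_sum)
  finally show ?thesis .
qed

section \<open>Translation to sums over bridges and bridge ends\<close>

text \<open>The symmetrised summand restores the orientation that \<open>bridges\<close>
  drops.\<close>

lemma sum_bridges:
  fixes F :: "'a \<Rightarrow> 'a \<Rightarrow> real"
  shows "(\<Sum>(x, y)\<in>bridges T c. F x y + F y x) = (\<Sum>(i, j)\<in>parcs T. F (c i j) (c j i))"
proof -
  let ?A = "{(i, j) \<in> parcs T. i < j}" and ?B = "{(i, j) \<in> parcs T. j < i}"
  let ?g = "\<lambda>(i, j). F (c i j) (c j i)"
  have fin: "finite ?A" "finite ?B"
    by (rule finite_subset[OF _ T.finite_parcs]; blast)+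
  have "inj_on (\<lambda>(i, j). (c i j, c j i)) (parcs T)"
  proof (rule inj_onI)
    fix e f
    assume "e \<in> parcs T" "f \<in> parcs T"
      and "(case e of (i, j) \<Rightarrow> (c i j, c j i)) = (case f of (i, j) \<Rightarrow> (c i j, c j i))"
    then show "e = f"
      using bridge_arc_eq by (cases e; cases f) auto
  qed
  then have inj: "inj_on (\<lambda>(i, j). (c i j, c j i)) ?A"
    by (rule inj_on_subset) blast
  have bridges: "bridges T c = (\<lambda>(i, j). (c i j, c j i)) ` ?A"
    unfolding bridges_def by force
  have "(\<Sum>(x, y)\<in>bridges T c. F x y + F y x) = (\<Sum>e\<in>?A. ?g e) + (\<Sum>(i, j)\<in>?A. ?g (j, i))"
    unfolding bridges sum.reindex[OF inj] sum.distrib[symmetric]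
    by (intro sum.cong refl) auto
  also have "(\<Sum>(i, j)\<in>?A. ?g (j, i)) = (\<Sum>e\<in>?B. ?g e)"
    using parcs_T_sym
    by (intro sum.reindex_bij_witness[of _ "\<lambda>(i, j). (j, i)" "\<lambda>(i, j). (j, i)"]) auto
  also have "(\<Sum>e\<in>?A. ?g e) + (\<Sum>e\<in>?B. ?g e) = (\<Sum>e\<in>?A \<union> ?B. ?g e)"
    using fin by (intro sum.union_disjoint[symmetric]) auto
  also have "?A \<union> ?B = parcs T"
    using parcs_T_verts(3) by (auto simp: nat_neq_iff)
  finally show ?thesis .
qed

lemma sum_bridge_ends:
  "(\<Sum>z\<in>bridge_ends T c i. F z) = (\<Sum>j\<in>nbrs T i. F (c i j, c j i))"
proof -
  have "bridge_ends T c i = (\<lambda>j. (c i j, c j i)) ` nbrs T i"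
    unfolding bridge_ends_def nbrs_def by blast
  moreover have "inj_on (\<lambda>j. (c i j, c j i)) (nbrs T i)"
    using inj_bridge_end by (simp add: inj_on_def)
  ultimately show ?thesis by (simp add: sum.reindex)
qed

lemma sum_parcs_T: "(\<Sum>(i, j)\<in>parcs T. g i j) = (\<Sum>i\<in>pverts T. \<Sum>j\<in>nbrs T i. g i j)"
proof -
  have "parcs T = (SIGMA i:pverts T. nbrs T i)"
    using T.parcs_subset by (auto simp: nbrs_def)
  then show ?thesis using T.finite_verts T.finite_nbrs by (simp add: sum.Sigma)
qed

lemma sum_bridges_accessibility:
  "(\<Sum>(x, y)\<in>bridges T c.
      Wbar G x y / real (num_edges G) * accessibility_index (part_of T Gs x) x
    + Wbar G y x / real (num_edges G) * accessibility_index (part_of T Gs y) y)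
  = (\<Sum>i\<in>pverts T. (\<Sum>j\<in>nbrs T i. (vol j i + 1) * accessibility_index (Gs i) (c i j))
      / (2 * real (num_edges G)))"
proof -
  have "Wbar G (c i j) (c j i) / real (num_edges G) * accessibility_index (part_of T Gs (c i j)) (c i j)
      = (vol j i + 1) * accessibility_index (Gs i) (c i j) / (2 * real (num_edges G))"
    if "j \<in> nbrs T i" for i j
  proof -
    have ij: "(i, j) \<in> parcs T" using that by (simp add: nbrs_def)
    show ?thesis
      by (simp add: vol_eq_Wbar[OF ij] part_of_eq[OF parcs_T_verts(1)[OF ij] c_in_part[OF ij]])
  qed
  then show ?thesis
    unfolding sum_bridges sum_parcs_T sum_divide_distrib by (intro sum.cong refl)
qed

text \<open>Each \<open>Wbar\<close> is half a gate mass and the commute time is 2 m_i times the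
  resistance, which turns 2 m_G m_i into 4 m_G. Coinciding ends agree with the \<open>if\<close>
  because \<open>hit\<close> vanishes on the diagonal.\<close>

lemma sum_bridge_ends_resistance:
  "(\<Sum>((z1, y1), (z2, y2))\<in>bridge_ends T c i \<times> bridge_ends T c i.
      if z1 = z2 then 0
      else Wbar G z1 y1 * Wbar G z2 y2 / (2 * real (num_edges G) * real (num_edges (Gs i)))
           * (mfpt (Gs i) z1 z2 + mfpt (Gs i) z2 z1))
  = (\<Sum>j\<in>nbrs T i. \<Sum>j'\<in>nbrs T i.
      (vol j i + 1) * (vol j' i + 1) * resistance (Gs i) (c i j) (c i j')) / (4 * real (num_edges G))"
proof -
  have "(if c i j = c i j' then 0
      else Wbar G (c i j) (c j i) * Wbar G (c i j') (c j' i)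
           / (2 * real (num_edges G) * real (num_edges (Gs i)))
           * (mfpt (Gs i) (c i j) (c i j') + mfpt (Gs i) (c i j') (c i j)))
    = (vol j i + 1) * (vol j' i + 1) * resistance (Gs i) (c i j) (c i j') / (4 * real (num_edges G))"
    if "j \<in> nbrs T i" "j' \<in> nbrs T i" for j j'
  proof -
    have "(i, j) \<in> parcs T" "(i, j') \<in> parcs T" using that by (simp_all add: nbrs_def)
    then show ?thesis
      by (simp add: vol_eq_Wbar resistance_def hit_def mult_ac)
  qed
  then show ?thesis
    unfolding sum.cartesian_product' sum_bridge_ends prod.case sum_divide_distrib
    by (intro sum.cong refl)
qed

text \<open>The summand is symmetric in the two ends, so passing from bridges to arcs doubles the
  denominator.\<close>

lemma sum_bridges_vol:
  "(\<Sum>(x, y)\<in>bridges T c. (2 * Wbar G x y - 1) * (2 * Wbar G y x - 1) / (2 * real (num_edges G)))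
  = (\<Sum>(i, j)\<in>parcs T. vol i j * vol j i) / (4 * real (num_edges G))"
proof -
  let ?F = "\<lambda>x y. (2 * Wbar G x y - 1) * (2 * Wbar G y x - 1) / (4 * real (num_edges G))"
  have "(\<Sum>(x, y)\<in>bridges T c. (2 * Wbar G x y - 1) * (2 * Wbar G y x - 1) / (2 * real (num_edges G)))
      = (\<Sum>(x, y)\<in>bridges T c. ?F x y + ?F y x)"
    by (intro sum.cong refl) (auto simp: mult.commute)
  also have "\<dots> = (\<Sum>(i, j)\<in>parcs T. ?F (c i j) (c j i))"
    by (rule sum_bridges)
  also have "\<dots> = (\<Sum>(i, j)\<in>parcs T. vol i j * vol j i / (4 * real (num_edges G)))"
    by (intro sum.cong refl) (auto simp: vol_eq_Wbar parcs_T_sym)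
  finally show ?thesis by (simp add: sum_divide_distrib split_def)
qed

end

theorem theorem3p15:
  fixes k :: nat
    and T :: "nat pair_pre_digraph"
    and Gs :: "nat \<Rightarrow> 'a pair_pre_digraph"
    and c :: "nat \<Rightarrow> nat \<Rightarrow> 'a"
    and G :: "'a pair_pre_digraph"
  assumes "tree_graph T"
    and "pverts T = {1..k}"
    and "\<And>i. i \<in> {1..k} \<Longrightarrow> connected_graph (Gs i)"
    and "disjoint_family_on (\<lambda>i. pverts (Gs i)) {1..k}"
    and "\<And>i j. (i, j) \<in> parcs T \<Longrightarrow> c i j \<in> pverts (Gs i)"
    and "G = chain T Gs c"
    and "num_edges G \<ge> 1"
  shows "kemeny G =
      (\<Sum>i=1..k. kemeny (Gs i))
    + (\<Sum>(x, y)\<in>bridges T c.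
         Wbar G x y / real (num_edges G) * accessibility_index (part_of T Gs x) x
       + Wbar G y x / real (num_edges G) * accessibility_index (part_of T Gs y) y)
    + (\<Sum>i=1..k. \<Sum>((z1, y1), (z2, y2))\<in>bridge_ends T c i \<times> bridge_ends T c i.
         if z1 = z2 then 0
         else Wbar G z1 y1 * Wbar G z2 y2 / (2 * real (num_edges G) * real (num_edges (Gs i)))
              * (mfpt (Gs i) z1 z2 + mfpt (Gs i) z2 z1))
    + (\<Sum>(x, y)\<in>bridges T c.
         (2 * Wbar G x y - 1) * (2 * Wbar G y x - 1) / (2 * real (num_edges G)))"
proof -
  interpret chain: graph_chain T Gs c
    using assms by unfold_locales auto
  show ?thesis
    unfolding assms(6) chain.sum_bridges_accessibility chain.sum_bridge_ends_resistance
      chain.sum_bridges_vol chain.kemeny_chain[OF assms(7)[unfolded assms(6)]]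
      assms(2)[symmetric] sum.distrib ..
qed

end
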